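(* Assume that $G:\mathbb{R}\times X\times X\to X$ is continuous, that $p:\mathbb{R}\times X\to X$ is Lipschitz, i.e. there is $L_p\ge0$ with $\|p(t,u)-p(s,v)\|\le L_p(|s-t|+\|u-v\|)$ for all $(t,u),(s,v)\in\mathbb{R}\times X$, and that there are constants $C_1,C_2\ge0$ with $\|p(s,u)\|\le C_1\|u\|+C_2$ for all $(s,u)\in\mathbb{R}\times X$. Assume (A1), (A2), (A3) hold. Then the nonlinear mapping $B:\mathbb{R}\times C\to X$, $B(t,\psi)=G\big(t,\psi(0),F(t,\psi)\big)$, is continuous.
   Context: Let $X$ be a Banach space with norm $\|\cdot\|$, let $r>0$, and let $C=C([-r,0];X)$ be the space of continuous functions $[-r,0]\to X$ with the supremum norm $\|\cdot\|_C$. Let $g:[-r,0]\times\mathbb{R}\times C\to\mathbb{R}$ and $p:\mathbb{R}\times X\to X$, and define the delay functional $F:\mathbb{R}\times C\to X$ by the Stieltjes integral (in $\theta$) $F(t,\psi)=\int_{-r}^0 p(t,\psi(\theta))\,d g(\theta,t,\psi)$. Assumption (A1): for every $(t,\varphi)\in\mathbb{R}\times C$ the function $\theta\mapsto g(\theta,t,\varphi)$ is of bounded variation on $[-r,0]$, and there is $M_{Vg}>0$ such that its total variation $V_{-r}^0 g(\cdot,t,\varphi)\le M_{Vg}$ for all $(t,\varphi)\in\mathbb{R}\times C$. For each $(t,\varphi)$ decompose $g(\cdot,t,\varphi)=g_d(\cdot,t,\varphi)+g_c(\cdot,t,\varphi)$, where $g_d$ is the jump (step-function) part and $g_c=g_{ac}+g_s$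 is the continuous part (sum of the absolutely continuous part and the singular continuous part) of the Lebesgue decomposition of the bounded variation function $g(\cdot,t,\varphi)$. Assumption (A2): for every $\theta\in[-r,0]$, the map $(t,\varphi)\mapsto g_c(\theta,t,\varphi)$ is continuous on $\mathbb{R}\times C$. Assumption (A3): the discontinuity points $\{\theta_k\}\subset[-r,0]$ (finitely or countably many) of $g_d(\cdot,t,\varphi)$ are given by $\theta_k=-\eta_k(t,\varphi)$, with jumps $h_k(t,\varphi)=g_d(\theta_k+0,t,\varphi)-g_d(\theta_k-0,t,\varphi)$, where $\eta_k:\mathbb{R}\times C\to[0,r]$ and $h_k:\mathbb{R}\times C\to\mathbb{R}$ are continuous functions; moreover the series $\sum_k h_k(t,\varphi)$ converges absolutely and uniformly on every bounded subset of $\mathbb{R}\times C$. (Thus $\int_{-r}^0\chi(\theta)\,dg_d(\theta,t,\varphi)=\sum_k\chi(-\eta_k(t,\varphi))h_k(t,\varphi)$.) *)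

theory Defs
  imports "HOL-Analysis.Analysis"
begin

definition is_partition :: "real \<Rightarrow> real \<Rightarrow> real list \<Rightarrow> bool" where
  "is_partition a b xs \<longleftrightarrow> length xs \<ge> 2 \<and> xs ! 0 = a \<and> last xs = b \<and> sorted_wrt (<) xs"

definition var_sum :: "(real \<Rightarrow> real) \<Rightarrow> real list \<Rightarrow> real" where
  "var_sum f xs = (\<Sum>i < length xs - 1. \<bar>f (xs ! Suc i) - f (xs ! i)\<bar>)"

definition bounded_variation_on :: "real \<Rightarrow> real \<Rightarrow> (real \<Rightarrow> real) \<Rightarrow> bool" where
  "bounded_variation_on a b f \<longleftrightarrow> bdd_above (var_sum f ` {xs. is_partition a b xs})"

definition total_variation :: "real \<Rightarrow> real \<Rightarrow> (real \<Rightarrow> real) \<Rightarrow> real" where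
  "total_variation a b f = (SUP xs \<in> {xs. is_partition a b xs}. var_sum f xs)"

definition tagged_partition :: "real \<Rightarrow> real \<Rightarrow> real list \<Rightarrow> real list \<Rightarrow> bool" where
  "tagged_partition a b xs ts \<longleftrightarrow> is_partition a b xs \<and> length ts = length xs - 1 \<and>
     (\<forall>i < length ts. xs ! i \<le> ts ! i \<and> ts ! i \<le> xs ! Suc i)"

definition mesh :: "real list \<Rightarrow> real" where
  "mesh xs = Max (insert 0 ((\<lambda>i. xs ! Suc i - xs ! i) ` {..< length xs - 1}))"

definition RS_sum :: "(real \<Rightarrow> 'a::real_normed_vector) \<Rightarrow> (real \<Rightarrow> real) \<Rightarrow> real list \<Rightarrow> real list \<Rightarrow> 'a" where
  "RS_sum c \<alpha> xs ts = (\<Sum>i < length ts. (\<alpha> (xs ! Suc i) - \<alpha> (xs ! i)) *\<^sub>R c (ts ! i))"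

definition has_RS_integral :: "(real \<Rightarrow> 'a::real_normed_vector) \<Rightarrow> (real \<Rightarrow> real) \<Rightarrow> real \<Rightarrow> real \<Rightarrow> 'a \<Rightarrow> bool" where
  "has_RS_integral c \<alpha> a b I \<longleftrightarrow>
     (\<forall>\<epsilon>>0. \<exists>\<delta>>0. \<forall>xs ts. tagged_partition a b xs ts \<and> mesh xs < \<delta> \<longrightarrow>
        norm (RS_sum c \<alpha> xs ts - I) < \<epsilon>)"

definition RS_integral :: "real \<Rightarrow> real \<Rightarrow> (real \<Rightarrow> 'a::real_normed_vector) \<Rightarrow> (real \<Rightarrow> real) \<Rightarrow> 'a" where
  "RS_integral a b c \<alpha> = (THE I. has_RS_integral c \<alpha> a b I)"

definition left_lim :: "real \<Rightarrow> (real \<Rightarrow> real) \<Rightarrow> real \<Rightarrow> real" where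
  "left_lim a f x = Lim (at x within {a..<x}) f"

definition right_lim :: "real \<Rightarrow> (real \<Rightarrow> real) \<Rightarrow> real \<Rightarrow> real" where
  "right_lim b f x = Lim (at x within {x<..b}) f"

definition jump_part :: "real \<Rightarrow> real \<Rightarrow> (real \<Rightarrow> real) \<Rightarrow> real \<Rightarrow> real" where
  "jump_part a b f x =
     (if x \<le> a then 0
      else (right_lim b f a - f a)
         + infsum (\<lambda>y. right_lim b f y - left_lim a f y) {a<..<x}
         + (f x - left_lim a f x))"

definition cont_part :: "real \<Rightarrow> real \<Rightarrow> (real \<Rightarrow> real) \<Rightarrow> real \<Rightarrow> real" where
  "cont_part a b f x = f x - jump_part a b f x"

text \<open>Jump of a function h on [a,b] at x, with h extended constantly outside [a,b]:
  h(x+0) - h(x-0), where h(a-0) = h(a) and h(b+0) = h(b).\<close>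
definition jump_at :: "real \<Rightarrow> real \<Rightarrow> (real \<Rightarrow> real) \<Rightarrow> real \<Rightarrow> real" where
  "jump_at a b h x = (if x = b then h b else right_lim b h x) - (if x = a then h a else left_lim a h x)"

text \<open>Elements of C([-r,0];X) are represented canonically by functions real \<Rightarrow> X that are
  continuous on [-r,0] and zero outside [-r,0].\<close>
definition Cspace :: "real \<Rightarrow> (real \<Rightarrow> 'a::real_normed_vector) set" where
  "Cspace r = {\<psi>. continuous_on {-r..0} \<psi> \<and> (\<forall>\<theta>. \<theta> \<notin> {-r..0} \<longrightarrow> \<psi> \<theta> = 0)}"

definition normC :: "real \<Rightarrow> (real \<Rightarrow> 'a::real_normed_vector) \<Rightarrow> real" where
  "normC r \<psi> = (SUP \<theta> \<in> {-r..0}. norm (\<psi> \<theta>))"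

definition contRC :: "real \<Rightarrow> (real \<Rightarrow> (real \<Rightarrow> 'a::real_normed_vector) \<Rightarrow> 'b::metric_space) \<Rightarrow> bool" where
  "contRC r f \<longleftrightarrow>
     (\<forall>t. \<forall>\<psi> \<in> Cspace r. \<forall>\<epsilon>>0. \<exists>\<delta>>0. \<forall>s. \<forall>\<phi> \<in> Cspace r.
        \<bar>s - t\<bar> < \<delta> \<and> normC r (\<lambda>\<theta>. \<phi> \<theta> - \<psi> \<theta>) < \<delta> \<longrightarrow> dist (f s \<phi>) (f t \<psi>) < \<epsilon>)"

end

theory Submission
  imports Defs
begin

text \<open>
  Fix a base point \<open>(t, \<psi>)\<close> and put \<open>\<gamma> \<theta> = p t (\<psi> \<theta>)\<close>. By the uniform bound on the variation of \<open>g\<close>, near the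
  base point the integral defining \<open>F\<close> differs little from one Riemann-Stieltjes sum of
  \<open>\<gamma>\<close> over a sufficiently fine uniform partition, and this partition does not depend on
  the nearby point. The sum splits into a part for the continuous component of \<open>g\<close>, which is
  continuous in the point by (A2) because it only involves finitely many values, and a part for
  the jump component. The sum over the jump component itself cannot be expected to depend
  continuously on the point, since jumps may cross the nodes; but it differs by a
  small multiple of the variation from the series of the \<open>h k *\<^sub>R \<gamma> (- \<eta> k)\<close>, which is
  continuous by (A3).
\<close>

section \<open>Riemann-Stieltjes integrals against functions of bounded variation\<close>

text \<open>The obstacle is that integrand, continuous component and jump points all move at once.
  Freezing the integrand at \<open>\<gamma>\<close> costs little because \<open>p\<close> is
  Lipschitz and the supremum norm controls all \<open>\<theta>\<close> together; this cost is
  multiplied by the variation, which (A1) bounds uniformly. Of the variation only a function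
  \<open>A\<close> with |f y - f x| <= A y - A x is kept: it bounds sums over arbitrary cells, makes
  \<open>A\<close> and \<open>A + f\<close> increasing, and so yields one-sided limits and summable
  jumps. Passing from the jump sum to the series is possible because a jump inside a cell is
  weighted with a tag at most one cell away, wherever the nodes lie; the error is a modulus of
  continuity times the jump variation, whatever the number of nodes. Since the value at a jump may
  lie anywhere relative to the two one-sided limits, left and right jumps are summed separately and
  merged only at the end, where (A3) speaks of total jumps.\<close>

definition controls_on :: "real set \<Rightarrow> (real \<Rightarrow> real) \<Rightarrow> (real \<Rightarrow> real) \<Rightarrow> bool" where
  "controls_on S A f \<longleftrightarrow> (\<forall>x\<in>S. \<forall>y\<in>S. x \<le> y \<longrightarrow> \<bar>f y - f x\<bar> \<le> A y - A x)"

lemma controls_onD: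
  "controls_on S A f \<Longrightarrow> x \<in> S \<Longrightarrow> y \<in> S \<Longrightarrow> x \<le> y \<Longrightarrow> \<bar>f y - f x\<bar> \<le> A y - A x"
  by (auto simp: controls_on_def)

lemma controls_on_mono:
  assumes "controls_on S A f" "x \<in> S" "y \<in> S" "x \<le> y"
  shows "A x \<le> A y"
  using controls_onD[OF assms] by linarith

lemma var_sum_Cons: "var_sum f (x # y # zs) = \<bar>f y - f x\<bar> + var_sum f (y # zs)"
  by (simp add: var_sum_def sum.lessThan_Suc_shift del: sum.lessThan_Suc)

lemma var_sum_snoc: "var_sum f (xs @ [x, y]) = var_sum f (xs @ [x]) + \<bar>f y - f x\<bar>"
proof -
  have "(xs @ [x, y]) ! i = (xs @ [x]) ! i" if "i \<le> length xs" for i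
    using that by (cases "i = length xs") (auto simp: nth_append)
  then show ?thesis
    by (simp add: var_sum_def nth_append[of xs "[x, y]" "Suc (length xs)"])
qed

lemma var_sum_le_total_variation:
  assumes "bounded_variation_on a b f" "is_partition a b xs"
  shows "var_sum f xs \<le> total_variation a b f"
  using assms unfolding bounded_variation_on_def total_variation_def
  by (intro cSUP_upper) auto

text \<open>A chain that does not start at \<open>a\<close> becomes a partition when
  \<open>a\<close> is put in front, which only adds a nonnegative term. Admitting such chains, and
  even an empty prefix, covers the degenerate interval [a, a] in the supremum below.\<close>

lemma var_sum_chain_le_total_variation:
  assumes bv: "bounded_variation_on a b f" and ab: "a < b"
    and xs: "sorted_wrt (<) (xs @ [b])" "set xs \<subseteq> {a..}"
  shows "var_sum f (xs @ [b]) \<le> total_variation a b f"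
proof (cases xs)
  case Nil
  have "is_partition a b [a, b]"
    using ab by (simp add: is_partition_def)
  from var_sum_le_total_variation[OF bv this] show ?thesis
    using Nil by (simp add: var_sum_def)
next
  case (Cons z zs)
  show ?thesis
  proof (cases "z = a")
    case True
    then have "is_partition a b (xs @ [b])"
      using xs Cons by (simp add: is_partition_def)
    then show ?thesis by (rule var_sum_le_total_variation[OF bv])
  next
    case False
    then have "is_partition a b (a # xs @ [b])"
      using xs Cons ab by (fastforce simp: is_partition_def)
    from var_sum_le_total_variation[OF bv this] show ?thesis
      using Cons by (simp add: var_sum_Cons)
  qed
qed

text \<open>\<open>A x\<close> is the supremum of the variation sums over chains ending at
  \<open>x\<close>. Appending \<open>y\<close> to such a chain adds exactly |f y - f x|, and this is
  the control inequality.\<close>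

lemma bounded_variation_control:
  assumes bv: "bounded_variation_on a b f" and ab: "a < b"
  obtains A where "controls_on {a..b} A f" "A b - A a \<le> total_variation a b f"
proof -
  define P where "P = (\<lambda>x. {xs. sorted_wrt (<) (xs @ [x]) \<and> set xs \<subseteq> {a..}})"
  define A where "A = (\<lambda>x. SUP xs \<in> P x. var_sum f (xs @ [x]))"
  have ext: "xs @ [x] \<in> P y" if "xs \<in> P x" "a \<le> x" "x < y" for xs x y
    using that by (fastforce simp: P_def sorted_wrt_append)
  have Nil: "[] \<in> P x" for x
    by (simp add: P_def)
  have top: "var_sum f (xs @ [b]) \<le> total_variation a b f" if "xs \<in> P b" for xs
    using var_sum_chain_le_total_variation[OF bv ab] that by (simp add: P_def)
  \<comment> \<open>For \<open>x < b\<close> the chain is continued to \<open>b\<close>, which only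
    increases its sum and brings it under \<open>top\<close>.\<close>
  have bound: "var_sum f (xs @ [x]) \<le> total_variation a b f" if "xs \<in> P x" "x \<in> {a..b}" for xs x
  proof (cases "x = b")
    case True then show ?thesis using that top by simp
  next
    case False
    then have "var_sum f (xs @ [x, b]) \<le> total_variation a b f"
      using top[OF ext[of xs x b]] that by simp
    then show ?thesis by (simp add: var_sum_snoc)
  qed
  have bdd: "bdd_above ((\<lambda>xs. var_sum f (xs @ [x])) ` P x)" if "x \<in> {a..b}" for x
    using bound that by (intro bdd_aboveI2) auto
  have up: "var_sum f (xs @ [x]) \<le> A x" if "xs \<in> P x" "x \<in> {a..b}" for xs x
    unfolding A_def using that bdd by (intro cSUP_upper) auto
  have "controls_on {a..b} A f"
    unfolding controls_on_def
  proof (intro ballI impI)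
    fix x y assume xy: "x \<in> {a..b}" "y \<in> {a..b}" "x \<le> y"
    show "\<bar>f y - f x\<bar> \<le> A y - A x"
    proof (cases "x = y")
      case False
      then have "x < y" using xy by simp
      have "A x \<le> A y - \<bar>f y - f x\<bar>"
      proof (subst A_def, rule cSUP_least)
        show "P x \<noteq> {}" using Nil by blast
        fix xs assume "xs \<in> P x"
        then have "var_sum f (xs @ [x, y]) \<le> A y"
          using up[OF ext, of xs x y] xy \<open>x < y\<close> by simp
        then show "var_sum f (xs @ [x]) \<le> A y - \<bar>f y - f x\<bar>"
          by (simp add: var_sum_snoc)
      qed
      then show ?thesis by simp
    qed simp
  qed
  moreover have "A b \<le> total_variation a b f"
    unfolding A_def using Nil top by (intro cSUP_least) auto
  moreover have "0 \<le> A a"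
    using up[OF Nil, of a] ab by (simp add: var_sum_def)
  ultimately show ?thesis
    using that by (smt (verit))
qed

section \<open>Uniform partitions and comparison of Riemann-Stieltjes sums\<close>

definition uniform_node :: "real \<Rightarrow> real \<Rightarrow> nat \<Rightarrow> nat \<Rightarrow> real" where
  "uniform_node a b n i = a + (b - a) * real i / real n"

text \<open>The nodes do not depend on the integrator, so a single \<open>n\<close> serves a whole
  neighbourhood of the base point.\<close>

definition uniform_sum :: "real \<Rightarrow> real \<Rightarrow> nat \<Rightarrow> (real \<Rightarrow> 'a::real_normed_vector) \<Rightarrow> (real \<Rightarrow> real) \<Rightarrow> 'a" where
  "uniform_sum a b n \<gamma> \<alpha> =
     (\<Sum>i<n. (\<alpha> (uniform_node a b n (Suc i)) - \<alpha> (uniform_node a b n i)) *\<^sub>R \<gamma> (uniform_node a b n i))"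

lemma uniform_node_0 [simp]: "uniform_node a b n 0 = a"
  by (simp add: uniform_node_def)

lemma uniform_node_n [simp]: "n > 0 \<Longrightarrow> uniform_node a b n n = b"
  by (simp add: uniform_node_def)

lemma uniform_node_Suc: "n > 0 \<Longrightarrow> uniform_node a b n (Suc i) = uniform_node a b n i + (b - a) / n"
  by (simp add: uniform_node_def field_simps)

lemma uniform_node_less: "n > 0 \<Longrightarrow> a < b \<Longrightarrow> i < j \<Longrightarrow> uniform_node a b n i < uniform_node a b n j"
  by (simp add: uniform_node_def divide_strict_right_mono)

lemma uniform_node_mono: "n > 0 \<Longrightarrow> a < b \<Longrightarrow> i \<le> j \<Longrightarrow> uniform_node a b n i \<le> uniform_node a b n j"
  using uniform_node_less[of n a b i j] by (cases "i = j") auto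

lemma uniform_node_in: "n > 0 \<Longrightarrow> a < b \<Longrightarrow> i \<le> n \<Longrightarrow> uniform_node a b n i \<in> {a..b}"
  using uniform_node_mono[of n a b 0 i] uniform_node_mono[of n a b i n] by simp

lemma uniform_tagged_partition:
  assumes n: "n > 0" and ab: "a < b"
  defines "xs \<equiv> map (uniform_node a b n) [0..<Suc n]" and "ts \<equiv> map (uniform_node a b n) [0..<n]"
  shows "tagged_partition a b xs ts" "mesh xs = (b - a) / n" "RS_sum \<gamma> \<alpha> xs ts = uniform_sum a b n \<gamma> \<alpha>"
proof -
  have nth: "xs ! i = uniform_node a b n i" if "i \<le> n" for i
    using that unfolding xs_def by (subst nth_map) (auto simp del: upt_Suc)
  have len: "length xs = Suc n" "length ts = n"
    by (auto simp: xs_def ts_def)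
  have "last xs = b"
    using n by (simp add: xs_def)
  moreover have "sorted_wrt (<) xs"
    unfolding sorted_wrt_iff_nth_less using len nth uniform_node_less[OF n ab] by auto
  ultimately show "tagged_partition a b xs ts"
    using n len nth uniform_node_mono[OF n ab]
    by (auto simp: tagged_partition_def is_partition_def ts_def)
  have "(\<lambda>i. xs ! Suc i - xs ! i) ` {..<n} = (\<lambda>i. (b - a) / n) ` {..<n}"
    using nth uniform_node_Suc[OF n] by (intro image_cong) auto
  also have "\<dots> = {(b - a) / n}" using n by auto
  finally show "mesh xs = (b - a) / n"
    using n ab by (simp add: mesh_def len)
  show "RS_sum \<gamma> \<alpha> xs ts = uniform_sum a b n \<gamma> \<alpha>"
    unfolding RS_sum_def uniform_sum_def len
    by (intro sum.cong) (auto simp: nth ts_def)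
qed

text \<open>\<open>S\<close> plays the indefinite integral and \<open>E\<close> the accumulated
  error. Both telescope over the nodes, so an estimate on short cells adds up to one on [a, b]. It
  is applied with \<open>S\<close> the integral of a step function and with \<open>S\<close> the
  integral against the jump component.\<close>

lemma RS_sum_close:
  assumes tp: "tagged_partition a b xs ts" and m: "mesh xs < d"
    and cell: "\<And>x t y. a \<le> x \<Longrightarrow> x \<le> t \<Longrightarrow> t \<le> y \<Longrightarrow> y \<le> b \<Longrightarrow> y - x < d \<Longrightarrow>
      norm ((\<alpha> y - \<alpha> x) *\<^sub>R \<xi> t - (S y - S x)) \<le> E y - E x"
  shows "norm (RS_sum \<xi> \<alpha> xs ts - (S b - S a)) \<le> E b - (E a :: real)"
proof -
  define n where "n = length ts"
  have len: "length xs = Suc n" "n > 0" and a: "xs ! 0 = a" and b: "xs ! n = b"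
    and sorted: "sorted_wrt (<) xs" and ts: "\<And>i. i < n \<Longrightarrow> xs ! i \<le> ts ! i \<and> ts ! i \<le> xs ! Suc i"
    using tp by (auto simp: tagged_partition_def is_partition_def n_def last_conv_nth simp flip: length_greater_0_conv)
  have le: "xs ! i \<le> xs ! j" if "i \<le> j" "j \<le> n" for i j
    using sorted_wrt_nth_less[OF sorted, of i j] that len by (cases "i = j") auto
  have gap: "xs ! Suc i - xs ! i < d" if "i < n" for i
  proof -
    have "xs ! Suc i - xs ! i \<le> mesh xs"
      unfolding mesh_def using that len by (intro Max_ge) auto
    then show ?thesis using m by simp
  qed
  have "RS_sum \<xi> \<alpha> xs ts - (S b - S a)
      = (\<Sum>i<n. (\<alpha> (xs ! Suc i) - \<alpha> (xs ! i)) *\<^sub>R \<xi> (ts ! i) - (S (xs ! Suc i) - S (xs ! i)))"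
    using sum_lessThan_telescope[of "\<lambda>i. S (xs ! i)" n]
    by (simp add: RS_sum_def sum_subtractf a b flip: n_def)
  also have "norm \<dots> \<le> (\<Sum>i<n. E (xs ! Suc i) - E (xs ! i))"
  proof (rule sum_norm_le)
    fix i assume "i \<in> {..<n}"
    then show "norm ((\<alpha> (xs ! Suc i) - \<alpha> (xs ! i)) *\<^sub>R \<xi> (ts ! i) - (S (xs ! Suc i) - S (xs ! i)))
        \<le> E (xs ! Suc i) - E (xs ! i)"
      using le[of 0 i] le[of "Suc i" n] ts[of i] gap[of i] by (intro cell) (auto simp: a b)
  qed
  also have "\<dots> = E b - E a"
    using sum_lessThan_telescope[of "\<lambda>i. E (xs ! i)" n] by (simp add: a b)
  finally show ?thesis .
qed

text \<open>\<open>cl i\<close> projects onto the \<open>i\<close>-th cell, so for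
  \<open>x \<le> y\<close> the \<open>i\<close>-th term is the increment of \<open>\<beta>\<close>
  over the part of [x, y] in that cell.\<close>

lemma uniform_cell_telescope:
  fixes \<beta> :: "real \<Rightarrow> real"
  assumes n: "n > 0" and ab: "a < b" and xy: "x \<in> {a..b}" "y \<in> {a..b}"
  defines "q \<equiv> uniform_node a b n"
  defines "cl \<equiv> \<lambda>i z. max (q i) (min z (q (Suc i)))"
  shows "(\<Sum>i<n. \<beta> (cl i y) - \<beta> (cl i x)) = \<beta> y - \<beta> x"
proof -
  have mono: "q i \<le> q (Suc i)" for i
    unfolding q_def by (rule uniform_node_mono[OF n ab]) simp
  \<comment> \<open>If \<open>z\<close> is at least \<open>q i\<close>, the second minimum is
    \<open>q i\<close>; otherwise both minima are \<open>z\<close> and cancel. In this form the sum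
    over \<open>i\<close> telescopes.\<close>
  have cl: "\<beta> (cl i z) = \<beta> (min z (q (Suc i))) - \<beta> (min z (q i)) + \<beta> (q i)" for i z
    using mono[of i] by (cases "z \<ge> q i") (auto simp: cl_def min_def max_def)
  have *: "(\<Sum>i<n. \<beta> (cl i z) - \<beta> (q i)) = \<beta> z - \<beta> a" if "z \<in> {a..b}" for z
    using sum_lessThan_telescope[of "\<lambda>i. \<beta> (min z (q i))" n] that n
    by (simp add: cl q_def min_absorb1 min_absorb2)
  have "(\<Sum>i<n. \<beta> (cl i y) - \<beta> (cl i x))
      = (\<Sum>i<n. \<beta> (cl i y) - \<beta> (q i)) - (\<Sum>i<n. \<beta> (cl i x) - \<beta> (q i))"
    by (simp flip: sum_subtractf)
  then show ?thesis using *[OF xy(1)] *[OF xy(2)] by simp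
qed

text \<open>The Stieltjes integral of the step function with value \<open>\<gamma> (q i)\<close> on the \<open>i\<close>-th cell of
  the uniform partition is additive over intervals, so no common refinement of the two partitions
  is needed.\<close>
lemma RS_sum_uniform_sum_close:
  fixes \<xi> \<gamma> :: "real \<Rightarrow> 'a::real_normed_vector"
  assumes A: "controls_on {a..b} A \<alpha>" and ab: "a < b" and n: "n > 0" "(b - a) / n < d / 2"
    and close: "\<And>x y. x \<in> {a..b} \<Longrightarrow> y \<in> {a..b} \<Longrightarrow> \<bar>x - y\<bar> < d \<Longrightarrow> norm (\<xi> x - \<gamma> y) \<le> e"
    and tp: "tagged_partition a b xs ts" "mesh xs < d / 2"
  shows "norm (RS_sum \<xi> \<alpha> xs ts - uniform_sum a b n \<gamma> \<alpha>) \<le> e * (A b - A a)"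
proof -
  define q where "q = uniform_node a b n"
  define cl where "cl = (\<lambda>i z. max (q i) (min z (q (Suc i))))"
  \<comment> \<open>Up to an additive constant, this is the integral up to \<open>z\<close> of the
    step function with value \<open>\<gamma> (q i)\<close> on cell \<open>i\<close>.\<close>
  define S where "S = (\<lambda>z. \<Sum>i<n. \<alpha> (cl i z) *\<^sub>R \<gamma> (q i))"
  have tele: "(\<Sum>i<n. \<beta> (cl i y) - \<beta> (cl i x)) = \<beta> y - \<beta> x"
    if "x \<in> {a..b}" "y \<in> {a..b}" for x y and \<beta> :: "real \<Rightarrow> real"
    unfolding cl_def q_def by (rule uniform_cell_telescope[OF n(1) ab that])
  have q: "q i \<in> {a..b}" if "i \<le> n" for i
    unfolding q_def by (rule uniform_node_in[OF n(1) ab that])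
  have qS: "q i < q (Suc i)" "q (Suc i) = q i + (b - a) / n" for i
    unfolding q_def using uniform_node_less[OF n(1) ab, of i "Suc i"] uniform_node_Suc[OF n(1)]
    by (blast, blast)
  have "S b - S a = uniform_sum a b n \<gamma> \<alpha>"
    unfolding S_def uniform_sum_def q_def[symmetric] sum_subtractf[symmetric]
  proof (intro sum.cong refl)
    fix i assume "i \<in> {..<n}"
    then have "cl i b = q (Suc i)" "cl i a = q i"
      using q[of i] q[of "Suc i"] qS(1)[of i] by (auto simp: cl_def)
    then show "\<alpha> (cl i b) *\<^sub>R \<gamma> (q i) - \<alpha> (cl i a) *\<^sub>R \<gamma> (q i) = (\<alpha> (q (Suc i)) - \<alpha> (q i)) *\<^sub>R \<gamma> (q i)"
      by (simp add: algebra_simps)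
  qed
  moreover have "norm (RS_sum \<xi> \<alpha> xs ts - (S b - S a)) \<le> e * A b - e * A a"
  proof (rule RS_sum_close[OF tp])
    fix x t y assume xty: "a \<le> x" "x \<le> t" "t \<le> y" "y \<le> b" "y - x < d / 2"
    then have xy: "x \<in> {a..b}" "y \<in> {a..b}" by auto
    have "(\<alpha> y - \<alpha> x) *\<^sub>R \<xi> t - (S y - S x)
        = (\<Sum>i<n. (\<alpha> (cl i y) - \<alpha> (cl i x)) *\<^sub>R (\<xi> t - \<gamma> (q i)))"
      unfolding S_def tele[OF xy, of \<alpha>, symmetric]
      by (simp add: scaleR_sum_left scaleR_right_diff_distrib scaleR_left_diff_distrib sum_subtractf)
    also have "norm \<dots> \<le> (\<Sum>i<n. e * (A (cl i y) - A (cl i x)))"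
    proof (rule sum_norm_le)
      fix i assume i: "i \<in> {..<n}"
      show "norm ((\<alpha> (cl i y) - \<alpha> (cl i x)) *\<^sub>R (\<xi> t - \<gamma> (q i))) \<le> e * (A (cl i y) - A (cl i x))"
      proof (cases "cl i y = cl i x")
        case False
        \<comment> \<open>Only cells that overlap [x, y] contribute. Then \<open>t\<close> is within
          one cell length plus \<open>y - x\<close> of \<open>q i\<close>, which is why both meshes
          are kept below \<open>d / 2\<close>.\<close>
        have "x < q (Suc i)" "q i < y"
          using False xty(2,3) qS(1)[of i] by (auto simp: cl_def min_def max_def split: if_splits)
        then have "\<bar>t - q i\<bar> < d"
          using xty qS(2)[of i] n(2) by linarith
        then have 1: "norm (\<xi> t - \<gamma> (q i)) \<le> e"
          using xty q[of i] i by (intro close) auto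
        have "cl i x \<in> {a..b}" "cl i y \<in> {a..b}" "cl i x \<le> cl i y"
          using i q[of i] q[of "Suc i"] qS(1)[of i] xty by (auto simp: cl_def)
        then have "\<bar>\<alpha> (cl i y) - \<alpha> (cl i x)\<bar> \<le> A (cl i y) - A (cl i x)"
          by (rule controls_onD[OF A])
        then have "\<bar>\<alpha> (cl i y) - \<alpha> (cl i x)\<bar> * norm (\<xi> t - \<gamma> (q i)) \<le> (A (cl i y) - A (cl i x)) * e"
          using 1 by (intro mult_mono) auto
        then show ?thesis by (simp add: mult.commute)
      qed simp
    qed
    also have "\<dots> = e * A y - e * A x"
      unfolding sum_distrib_left[symmetric] tele[OF xy] by (rule right_diff_distrib)
    finally show "norm ((\<alpha> y - \<alpha> x) *\<^sub>R \<xi> t - (S y - S x)) \<le> e * A y - e * A x" .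
  qed
  ultimately show ?thesis
    by (simp add: right_diff_distrib)
qed

section \<open>Uniqueness and existence of the integral\<close>

lemma eventually_uniform_mesh_less:
  assumes "(d::real) > 0"
  shows "\<forall>\<^sub>F n in sequentially. n > 0 \<and> (b - a) / real n < d"
proof -
  have "((\<lambda>n. (b - a) / real n) \<longlongrightarrow> 0) sequentially"
    by (rule lim_const_over_n)
  then have "\<forall>\<^sub>F n in sequentially. (b - a) / real n < d"
    using assms by (rule order_tendstoD)
  then show ?thesis
    using eventually_gt_at_top[of 0] by eventually_elim simp
qed

text \<open>For \<open>a < b\<close> there are uniform partitions of arbitrarily small mesh, so the
  defining condition is not vacuous. Uniqueness is what gives the description operator in
  \<open>RS_integral\<close> its meaning.\<close>

lemma has_RS_integral_unique:
  assumes ab: "a < b" and I: "has_RS_integral \<xi> \<alpha> a b I" and I': "has_RS_integral \<xi> \<alpha> a b I'"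
  shows "I = I'"
proof (rule ccontr)
  assume "I \<noteq> I'"
  then have e: "dist I I' / 2 > 0" by simp
  obtain d where d: "d > 0" "\<And>xs ts. tagged_partition a b xs ts \<Longrightarrow> mesh xs < d \<Longrightarrow>
      norm (RS_sum \<xi> \<alpha> xs ts - I) < dist I I' / 2"
    using I e unfolding has_RS_integral_def by blast
  obtain d' where d': "d' > 0" "\<And>xs ts. tagged_partition a b xs ts \<Longrightarrow> mesh xs < d' \<Longrightarrow>
      norm (RS_sum \<xi> \<alpha> xs ts - I') < dist I I' / 2"
    using I' e unfolding has_RS_integral_def by blast
  have "min d d' > 0" using d d' by simp
  from eventually_happens[OF eventually_uniform_mesh_less[OF this, of b a]]
  obtain n :: nat where n: "n > 0" "(b - a) / n < min d d'" by auto
  note u = uniform_tagged_partition[OF n(1) ab]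
  have "dist (uniform_sum a b n \<xi> \<alpha>) I < dist I I' / 2" "dist (uniform_sum a b n \<xi> \<alpha>) I' < dist I I' / 2"
    using d(2)[OF u(1)] d'(2)[OF u(1)] n(2) unfolding u(2,3) dist_norm by auto
  then show False
    using dist_triangle_half_r by blast
qed

lemma RS_integral_eq:
  assumes "a < b" "has_RS_integral \<xi> \<alpha> a b I"
  shows "RS_integral a b \<xi> \<alpha> = I"
  unfolding RS_integral_def using has_RS_integral_unique[OF assms(1)] assms(2) by blast

lemma continuous_on_Icc_modulus:
  fixes \<xi> :: "real \<Rightarrow> 'a::real_normed_vector"
  assumes "continuous_on {a..b} \<xi>" "e > 0"
  obtains d where "d > 0"
    "\<And>x y. x \<in> {a..b} \<Longrightarrow> y \<in> {a..b} \<Longrightarrow> \<bar>x - y\<bar> < d \<Longrightarrow> norm (\<xi> x - \<xi> y) \<le> e"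
proof -
  have "uniformly_continuous_on {a..b} \<xi>"
    using assms by (simp add: compact_uniformly_continuous)
  from uniformly_continuous_onE[OF this \<open>e > 0\<close>] show ?thesis
    using that by (metis dist_norm dist_commute dist_real_def less_imp_le)
qed

text \<open>Fine sums are compared with uniform ones, with the same integrand on both sides. Hence
  the uniform sums are Cauchy, completeness supplies a limit, and all fine sums follow.\<close>

lemma has_RS_integral_exists:
  fixes \<xi> :: "real \<Rightarrow> 'a::banach"
  assumes A: "controls_on {a..b} A \<alpha>" and ab: "a < b" and \<xi>: "continuous_on {a..b} \<xi>"
  shows "\<exists>I. has_RS_integral \<xi> \<alpha> a b I"
proof -
  define V where "V = A b - A a"
  have V: "V \<ge> 0"
    using controls_on_mono[OF A, of a b] ab by (simp add: V_def)
  have approx: "\<exists>d>0. \<exists>N. \<forall>n\<ge>N. n > 0 \<and> (b - a) / n < d \<and> (\<forall>xs ts. tagged_partition a b xs ts \<longrightarrow> mesh xs < d \<longrightarrow>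
      norm (RS_sum \<xi> \<alpha> xs ts - uniform_sum a b n \<xi> \<alpha>) < e)" if "e > 0" for e
  proof -
    \<comment> \<open>\<open>V\<close> may vanish; the denominator \<open>V + 1\<close> keeps the
      quotient positive and the final estimate strict.\<close>
    have e': "e / (V + 1) > 0" using that V by simp
    from continuous_on_Icc_modulus[OF \<xi> e'] obtain d where d: "d > 0"
      "\<And>x y. x \<in> {a..b} \<Longrightarrow> y \<in> {a..b} \<Longrightarrow> \<bar>x - y\<bar> < d \<Longrightarrow> norm (\<xi> x - \<xi> y) \<le> e / (V + 1)"
      by blast
    have "d / 2 > 0" using d by simp
    from eventually_uniform_mesh_less[OF this, of b a]
    obtain N where N: "\<And>n. n \<ge> N \<Longrightarrow> n > 0 \<and> (b - a) / real n < d / 2"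
      by (auto simp: eventually_sequentially)
    have "e / (V + 1) * V < e" using that V by (simp add: field_simps)
    then have "norm (RS_sum \<xi> \<alpha> xs ts - uniform_sum a b n \<xi> \<alpha>) < e"
      if "n \<ge> N" "tagged_partition a b xs ts" "mesh xs < d / 2" for n xs ts
      using RS_sum_uniform_sum_close[OF A ab _ _ d(2) that(2,3), of n] N[OF that(1)]
      unfolding V_def by fastforce
    then show ?thesis
      using \<open>d / 2 > 0\<close> N by blast
  qed
  have "Cauchy (\<lambda>n. uniform_sum a b n \<xi> \<alpha>)"
  proof (rule metric_CauchyI)
    fix e :: real assume "e > 0"
    from approx[OF this] obtain d N where dN: "\<And>n. n \<ge> N \<Longrightarrow> n > 0 \<and> (b - a) / real n < d"
      "\<And>n xs ts. n \<ge> N \<Longrightarrow> tagged_partition a b xs ts \<Longrightarrow> mesh xs < d \<Longrightarrow>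
          norm (RS_sum \<xi> \<alpha> xs ts - uniform_sum a b n \<xi> \<alpha>) < e"
      by blast
    have "dist (uniform_sum a b m \<xi> \<alpha>) (uniform_sum a b n \<xi> \<alpha>) < e" if "m \<ge> N" "n \<ge> N" for m n
      using dN(2)[OF that(2) uniform_tagged_partition(1)[of m, OF _ ab]] dN(1)[OF that(1)] ab
      by (simp add: uniform_tagged_partition dist_norm del: upt_Suc)
    then show "\<exists>M. \<forall>m\<ge>M. \<forall>n\<ge>M. dist (uniform_sum a b m \<xi> \<alpha>) (uniform_sum a b n \<xi> \<alpha>) < e"
      by blast
  qed
  then obtain I where I: "(\<lambda>n. uniform_sum a b n \<xi> \<alpha>) \<longlonglongrightarrow> I"
    using Cauchy_convergent convergent_def by blast
  have "has_RS_integral \<xi> \<alpha> a b I"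
    unfolding has_RS_integral_def
  proof (intro allI impI)
    fix e :: real assume "e > 0"
    then have e2: "e / 2 > 0" by simp
    from approx[OF this] obtain d N where dN: "d > 0"
      "\<And>n xs ts. n \<ge> N \<Longrightarrow> tagged_partition a b xs ts \<Longrightarrow> mesh xs < d \<Longrightarrow>
          norm (RS_sum \<xi> \<alpha> xs ts - uniform_sum a b n \<xi> \<alpha>) < e / 2"
      by blast
    obtain N' where N': "\<And>n. n \<ge> N' \<Longrightarrow> norm (uniform_sum a b n \<xi> \<alpha> - I) < e / 2"
      using LIMSEQ_D[OF I e2] by blast
    have "norm (RS_sum \<xi> \<alpha> xs ts - I) < e" if "tagged_partition a b xs ts" "mesh xs < d" for xs ts
      using norm_diff_triangle_less[OF dN(2)[of "max N N'", OF _ that] N'[of "max N N'"]] by simp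
    then show "\<exists>d>0. \<forall>xs ts. tagged_partition a b xs ts \<and> mesh xs < d \<longrightarrow> norm (RS_sum \<xi> \<alpha> xs ts - I) < e"
      using dN(1) by blast
  qed
  then show ?thesis by blast
qed

text \<open>The comparison of sums is applied to a uniform partition fine enough to approximate the
  integral, and the error \<open>e'\<close> is arbitrary. The hypothesis on \<open>\<xi>\<close> and
  \<open>\<gamma>\<close> covers a shift of the argument and a change of integrand at once.\<close>

lemma RS_integral_uniform_sum_close:
  fixes \<xi> \<gamma> :: "real \<Rightarrow> 'a::banach"
  assumes A: "controls_on {a..b} A \<alpha>" and ab: "a < b" and \<xi>: "continuous_on {a..b} \<xi>"
    and n: "n > 0" "(b - a) / n < d / 2"
    and close: "\<And>x y. x \<in> {a..b} \<Longrightarrow> y \<in> {a..b} \<Longrightarrow> \<bar>x - y\<bar> < d \<Longrightarrow> norm (\<xi> x - \<gamma> y) \<le> e"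
  shows "norm (RS_integral a b \<xi> \<alpha> - uniform_sum a b n \<gamma> \<alpha>) \<le> e * (A b - A a)"
proof (rule field_le_epsilon)
  fix e' :: real assume "e' > 0"
  obtain I where I: "has_RS_integral \<xi> \<alpha> a b I"
    using has_RS_integral_exists[OF A ab \<xi>] by blast
  obtain d' where d': "d' > 0" "\<And>xs ts. tagged_partition a b xs ts \<Longrightarrow> mesh xs < d' \<Longrightarrow>
      norm (RS_sum \<xi> \<alpha> xs ts - I) < e'"
    using I \<open>e' > 0\<close> unfolding has_RS_integral_def by blast
  have "0 < (b - a) / n" using ab n by simp
  then have "min d' (d / 2) > 0" using d' n(2) by linarith
  from eventually_happens[OF eventually_uniform_mesh_less[OF this, of b a]]
  obtain m :: nat where m: "m > 0" "(b - a) / m < d'" "(b - a) / m < d / 2" by auto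
  note u = uniform_tagged_partition[OF m(1) ab]
  have "norm (uniform_sum a b m \<xi> \<alpha> - I) < e'"
    using d'(2)[OF u(1)] m unfolding u(2,3) by simp
  moreover have "norm (uniform_sum a b m \<xi> \<alpha> - uniform_sum a b n \<gamma> \<alpha>) \<le> e * (A b - A a)"
    using RS_sum_uniform_sum_close[OF A ab n close u(1)] m unfolding u(2,3) by simp
  ultimately show "norm (RS_integral a b \<xi> \<alpha> - uniform_sum a b n \<gamma> \<alpha>) \<le> e * (A b - A a) + e'"
    unfolding RS_integral_eq[OF ab I]
    using norm_diff_triangle_le[of I "uniform_sum a b m \<xi> \<alpha>"] by (smt (verit) norm_minus_commute)
qed

section \<open>Jumps of functions of bounded variation\<close>

definition ljump :: "(real \<Rightarrow> real) \<Rightarrow> real \<Rightarrow> real" where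
  "ljump f x = f x - Lim (at_left x) f"

definition rjump :: "(real \<Rightarrow> real) \<Rightarrow> real \<Rightarrow> real" where
  "rjump f x = Lim (at_right x) f - f x"

lemma ljump_eqI: "(f \<longlongrightarrow> l) (at_left x) \<Longrightarrow> ljump f x = f x - l"
  by (simp add: ljump_def tendsto_Lim)

lemma rjump_eqI: "(f \<longlongrightarrow> l) (at_right x) \<Longrightarrow> rjump f x = l - f x"
  by (simp add: rjump_def tendsto_Lim)

lemma mono_tendsto_at_left:
  fixes g :: "real \<Rightarrow> real"
  assumes "mono g"
  shows "\<exists>l. (g \<longlongrightarrow> l) (at_left x)"
proof
  have bdd: "bdd_above (g ` {..<x})"
    using assms by (intro bdd_aboveI2[of _ _ "g x"]) (auto intro: monoD)
  show "(g \<longlongrightarrow> Sup (g ` {..<x})) (at_left x)"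
  proof (rule increasing_tendsto)
    show "\<forall>\<^sub>F z in at_left x. g z \<le> Sup (g ` {..<x})"
      using bdd by (auto simp: eventually_at_filter intro!: cSUP_upper always_eventually)
    fix c assume "c < Sup (g ` {..<x})"
    then obtain z where z: "z < x" "c < g z"
      using less_cSUP_iff[OF _ bdd, of c] by auto
    show "\<forall>\<^sub>F z in at_left x. c < g z"
      using eventually_at_left_real[OF z(1)]
    proof eventually_elim
      case (elim w)
      then show ?case using monoD[OF assms, of z w] z(2) by auto
    qed
  qed
qed

lemma mono_tendsto_at_right:
  fixes g :: "real \<Rightarrow> real"
  assumes "mono g"
  shows "\<exists>l. (g \<longlongrightarrow> l) (at_right x)"
proof -
  have "mono (\<lambda>z. - g (- z))"
    using assms by (auto simp: mono_def)
  from mono_tendsto_at_left[OF this, of "- x"] obtain l where "((\<lambda>z. - g (- z)) \<longlongrightarrow> l) (at_left (- x))"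
    by blast
  then have "((\<lambda>z. - g z) \<longlongrightarrow> l) (at_right x)"
    by (subst (asm) at_left_minus) (simp add: filterlim_filtermap)
  then show ?thesis
    using tendsto_minus_cancel_left by blast
qed

lemma infsum_interval_diff:
  fixes j :: "real \<Rightarrow> 'a::banach"
  assumes "j summable_on UNIV" "x \<le> y"
  shows "infsum j {..<y} - infsum j {..<x} = infsum j {x..<y}"
    and "infsum j {..y} - infsum j {..x} = infsum j {x<..y}"
proof -
  have s: "j summable_on B" for B
    using assms(1) by (rule summable_on_subset_banach) simp
  have "{..<y} = {..<x} \<union> {x..<y}" "{..y} = {..x} \<union> {x<..y}"
    using assms(2) by auto
  then show "infsum j {..<y} - infsum j {..<x} = infsum j {x..<y}"
    and "infsum j {..y} - infsum j {..x} = infsum j {x<..y}"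
    using infsum_Un_disjoint[OF s s, of "{..<x}" "{x..<y}"] infsum_Un_disjoint[OF s s, of "{..x}" "{x<..y}"]
    by (auto simp: disjoint_iff)
qed

text \<open>Working on the whole line avoids cases at end points; \<open>V\<close> bounds the total
  increase of \<open>A\<close> and thereby every sum of jumps.\<close>

locale controlled =
  fixes f A :: "real \<Rightarrow> real" and V :: real
  assumes control: "controls_on UNIV A f" and bound: "\<And>x y. A y - A x \<le> V"
begin

lemma diff_le: "x \<le> y \<Longrightarrow> \<bar>f y - f x\<bar> \<le> A y - A x"
  using control by (simp add: controls_on_def)

lemma mono_A: "mono A"
  using diff_le by (fastforce simp: mono_def)

lemma mono_A_plus: "mono (\<lambda>x. A x + f x)"
  using diff_le by (fastforce simp: mono_def)

text \<open>Jordan decomposition: \<open>f\<close> is the difference of the increasing functions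
  \<open>A + f\<close> and \<open>A\<close>, which have one-sided limits.\<close>

lemma ljump_tendsto: "(f \<longlongrightarrow> f x - ljump f x) (at_left x)" "(A \<longlongrightarrow> A x - ljump A x) (at_left x)"
proof -
  obtain k l where kl: "(A \<longlongrightarrow> k) (at_left x)" "((\<lambda>x. A x + f x) \<longlongrightarrow> l) (at_left x)"
    using mono_tendsto_at_left[OF mono_A] mono_tendsto_at_left[OF mono_A_plus] by blast
  show "(A \<longlongrightarrow> A x - ljump A x) (at_left x)"
    using kl(1) by (simp add: ljump_eqI)
  have "(f \<longlongrightarrow> l - k) (at_left x)"
    using tendsto_diff[OF kl(2,1)] by simp
  then show "(f \<longlongrightarrow> f x - ljump f x) (at_left x)"
    by (simp add: ljump_eqI)
qed

lemma rjump_tendsto: "(f \<longlongrightarrow> f x + rjump f x) (at_right x)" "(A \<longlongrightarrow> A x + rjump A x) (at_right x)"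
proof -
  obtain k l where kl: "(A \<longlongrightarrow> k) (at_right x)" "((\<lambda>x. A x + f x) \<longlongrightarrow> l) (at_right x)"
    using mono_tendsto_at_right[OF mono_A] mono_tendsto_at_right[OF mono_A_plus] by blast
  show "(A \<longlongrightarrow> A x + rjump A x) (at_right x)"
    using kl(1) by (simp add: rjump_eqI)
  have "(f \<longlongrightarrow> l - k) (at_right x)"
    using tendsto_diff[OF kl(2,1)] by simp
  then show "(f \<longlongrightarrow> f x + rjump f x) (at_right x)"
    by (simp add: rjump_eqI)
qed

lemma abs_ljump_le: "\<bar>ljump f x\<bar> \<le> ljump A x"
proof -
  have "\<bar>f x - (f x - ljump f x)\<bar> \<le> A x - (A x - ljump A x)"
    by (rule tendsto_le[OF _ tendsto_diff[OF tendsto_const ljump_tendsto(2)]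
          tendsto_rabs[OF tendsto_diff[OF tendsto_const ljump_tendsto(1)]]])
       (auto simp: eventually_at_filter intro!: always_eventually diff_le)
  then show ?thesis by simp
qed

lemma abs_rjump_le: "\<bar>rjump f x\<bar> \<le> rjump A x"
proof -
  have "\<bar>(f x + rjump f x) - f x\<bar> \<le> (A x + rjump A x) - A x"
    by (rule tendsto_le[OF _ tendsto_diff[OF rjump_tendsto(2) tendsto_const]
          tendsto_rabs[OF tendsto_diff[OF rjump_tendsto(1) tendsto_const]]])
       (auto simp: eventually_at_filter intro!: always_eventually diff_le)
  then show ?thesis by simp
qed

lemma ljump_A_le: "z < x \<Longrightarrow> A z \<le> A x - ljump A x"
  by (rule tendsto_lowerbound[OF ljump_tendsto(2)])
     (auto intro!: eventually_mono[OF eventually_at_left_real] monoD[OF mono_A])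

lemma rjump_A_le: "x < z \<Longrightarrow> A x + rjump A x \<le> A z"
  by (rule tendsto_upperbound[OF rjump_tendsto(2)])
     (auto intro!: eventually_mono[OF eventually_at_right_real] monoD[OF mono_A])

definition jump_mass :: "real \<Rightarrow> real" where
  "jump_mass x = \<bar>ljump f x\<bar> + \<bar>rjump f x\<bar>"

lemma jump_mass_nonneg: "0 \<le> jump_mass x"
  by (simp add: jump_mass_def)

text \<open>Induction on the largest point \<open>z\<close>: a number \<open>u\<close> separates it
  from the other points, so the increase of \<open>A\<close> from \<open>lo\<close> to
  \<open>u\<close> and its two jumps at \<open>z\<close> fit side by side into the increase from
  \<open>lo\<close> to \<open>hi\<close>.\<close>

lemma sum_jump_mass_le:
  assumes "finite Y" "Y \<subseteq> {lo<..<hi}" "lo \<le> hi"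
  shows "sum jump_mass Y \<le> A hi - A lo"
  using assms
proof (induction Y arbitrary: hi rule: finite_linorder_max_induct)
  case empty
  then show ?case using monoD[OF mono_A] by simp
next
  case (insert z Y)
  obtain u where u: "lo \<le> u" "u < z" "Y \<subseteq> {lo<..<u}"
  proof (cases "Y = {}")
    case True
    then show ?thesis using that[of lo] insert.prems by auto
  next
    case False
    then have "Max Y \<in> Y" using insert.hyps by simp
    then have "lo < Max Y" "Max Y < z"
      using insert.hyps insert.prems by auto
    moreover from this obtain u where "Max Y < u" "u < z" using dense by blast
    ultimately show ?thesis
      using that[of u] insert.prems Max_ge[OF \<open>finite Y\<close>] by fastforce
  qed
  have "sum jump_mass (insert z Y) = jump_mass z + sum jump_mass Y"
    using insert.hyps by (subst sum.insert) auto
  also have "\<dots> \<le> (ljump A z + rjump A z) + (A u - A lo)"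
    unfolding jump_mass_def using insert.IH[OF u(3,1)] abs_ljump_le[of z] abs_rjump_le[of z] by (simp add: jump_mass_def)
  also have "\<dots> \<le> A hi - A lo"
    using ljump_A_le[OF u(2)] rjump_A_le[of z hi] insert.prems by simp
  finally show ?case .
qed

lemma sum_jump_mass_le_V: "finite Y \<Longrightarrow> sum jump_mass Y \<le> V"
proof (cases "Y = {}")
  case True
  then show ?thesis using bound[of 0 0] by simp
next
  case False
  assume Y: "finite Y"
  have "Y \<subseteq> {Min Y..Max Y}" using Y by auto
  then have "Y \<subseteq> {Min Y - 1<..<Max Y + 1}" "Min Y - 1 \<le> Max Y + 1"
    using False by fastforce+
  then have "sum jump_mass Y \<le> A (Max Y + 1) - A (Min Y - 1)"
    using Y by (intro sum_jump_mass_le)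
  then show ?thesis using bound[of "Max Y + 1" "Min Y - 1"] by linarith
qed

lemma jump_mass_summable: "jump_mass summable_on B"
  by (rule nonneg_bdd_above_summable_on) (auto simp: jump_mass_nonneg intro!: bdd_aboveI2 sum_jump_mass_le_V)

lemma infsum_jump_mass_le: "infsum jump_mass B \<le> V"
  by (rule infsum_le_finite_sums[OF jump_mass_summable]) (rule sum_jump_mass_le_V)

lemma jump_abs_summable:
  "(\<lambda>x. \<bar>ljump f x\<bar>) summable_on B" "(\<lambda>x. \<bar>rjump f x\<bar>) summable_on B"
  by (rule summable_on_comparison_test[OF jump_mass_summable]; simp add: jump_mass_def)+

lemma weighted_jump_summable:
  fixes \<gamma> :: "real \<Rightarrow> 'a::banach"
  assumes "bounded (\<gamma> ` B)"
  shows "(\<lambda>z. ljump f z *\<^sub>R \<gamma> z) summable_on B" "(\<lambda>z. rjump f z *\<^sub>R \<gamma> z) summable_on B"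
proof -
  obtain c where c: "\<And>z. z \<in> B \<Longrightarrow> norm (\<gamma> z) \<le> c"
    using assms by (auto simp: bounded_iff)
  have "(\<lambda>z. norm (j z *\<^sub>R \<gamma> z)) summable_on B" if "(\<lambda>z. \<bar>j z\<bar>) summable_on B" for j :: "real \<Rightarrow> real"
    using summable_on_cmult_left[OF that, of c]
    by (rule summable_on_comparison_test) (auto intro!: mult_left_mono c)
  then show "(\<lambda>z. ljump f z *\<^sub>R \<gamma> z) summable_on B" "(\<lambda>z. rjump f z *\<^sub>R \<gamma> z) summable_on B"
    using jump_abs_summable by (auto intro: abs_summable_summable)
qed

text \<open>The integral of \<open>\<gamma>\<close> against the jump component, up to
  \<open>x\<close>. The function value at \<open>x\<close> has already absorbed the left jump at
  \<open>x\<close> but not the right one; hence the open range for \<open>rjump\<close> and the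
  closed one for \<open>ljump\<close>.\<close>

definition jump_integral :: "(real \<Rightarrow> 'a::banach) \<Rightarrow> real \<Rightarrow> 'a" where
  "jump_integral \<gamma> x = (\<Sum>\<^sub>\<infinity>z\<in>{..<x}. rjump f z *\<^sub>R \<gamma> z) + (\<Sum>\<^sub>\<infinity>z\<in>{..x}. ljump f z *\<^sub>R \<gamma> z)"

definition jump_variation :: "real \<Rightarrow> real" where
  "jump_variation x = (\<Sum>\<^sub>\<infinity>z\<in>{..<x}. \<bar>rjump f z\<bar>) + (\<Sum>\<^sub>\<infinity>z\<in>{..x}. \<bar>ljump f z\<bar>)"

lemma jump_integral_diff:
  fixes \<gamma> :: "real \<Rightarrow> 'a::banach"
  assumes "bounded (range \<gamma>)" "x \<le> y"
  shows "jump_integral \<gamma> y - jump_integral \<gamma> x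
    = (\<Sum>\<^sub>\<infinity>z\<in>{x..<y}. rjump f z *\<^sub>R \<gamma> z) + (\<Sum>\<^sub>\<infinity>z\<in>{x<..y}. ljump f z *\<^sub>R \<gamma> z)"
  unfolding jump_integral_def
    infsum_interval_diff(1)[OF weighted_jump_summable(2)[OF assms(1)] assms(2), symmetric]
    infsum_interval_diff(2)[OF weighted_jump_summable(1)[OF assms(1)] assms(2), symmetric]
  by simp

lemma jump_variation_diff:
  assumes "x \<le> y"
  shows "jump_variation y - jump_variation x = (\<Sum>\<^sub>\<infinity>z\<in>{x..<y}. \<bar>rjump f z\<bar>) + (\<Sum>\<^sub>\<infinity>z\<in>{x<..y}. \<bar>ljump f z\<bar>)"
  unfolding jump_variation_def
    infsum_interval_diff(1)[OF jump_abs_summable(2) assms, symmetric]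
    infsum_interval_diff(2)[OF jump_abs_summable(1) assms, symmetric]
  by simp

lemma jump_variation_diff_le_V:
  assumes "x \<le> y"
  shows "jump_variation y - jump_variation x \<le> V"
proof -
  have "jump_variation y - jump_variation x \<le> (\<Sum>\<^sub>\<infinity>z. \<bar>rjump f z\<bar>) + (\<Sum>\<^sub>\<infinity>z. \<bar>ljump f z\<bar>)"
    unfolding jump_variation_diff[OF assms] by (intro add_mono infsum_mono2 jump_abs_summable) auto
  also have "\<dots> = infsum jump_mass UNIV"
    unfolding jump_mass_def by (subst infsum_add) (auto simp: jump_abs_summable)
  finally show ?thesis using infsum_jump_mass_le[of UNIV] by simp
qed

lemma norm_jump_integral_diff_le:
  fixes \<gamma> :: "real \<Rightarrow> 'a::banach"
  assumes "bounded (range \<gamma>)" "x \<le> y" and e: "\<And>z. z \<in> {x..y} \<Longrightarrow> norm (\<gamma> z) \<le> e"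
  shows "norm (jump_integral \<gamma> y - jump_integral \<gamma> x) \<le> e * (jump_variation y - jump_variation x)"
proof -
  have *: "norm (\<Sum>\<^sub>\<infinity>z\<in>B. j z *\<^sub>R \<gamma> z) \<le> e * (\<Sum>\<^sub>\<infinity>z\<in>B. \<bar>j z\<bar>)"
    if B: "B \<subseteq> {x..y}" and j: "(\<lambda>z. \<bar>j z\<bar>) summable_on B" "(\<lambda>z. j z *\<^sub>R \<gamma> z) summable_on B" for j :: "real \<Rightarrow> real" and B
  proof (rule norm_infsum_le[OF has_sum_infsum[OF j(2)] has_sum_cmult_right[OF has_sum_infsum[OF j(1)]]])
    fix z assume "z \<in> B"
    then have "\<bar>j z\<bar> * norm (\<gamma> z) \<le> \<bar>j z\<bar> * e" using e B by (intro mult_left_mono) auto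
    then show "norm (j z *\<^sub>R \<gamma> z) \<le> e * \<bar>j z\<bar>" by (simp add: mult.commute)
  qed
  have bdd: "bounded (\<gamma> ` B)" for B
    using assms(1) by (rule bounded_subset) auto
  show ?thesis
    unfolding jump_integral_diff[OF assms(1,2)] jump_variation_diff[OF assms(2)] distrib_left
    by (intro norm_triangle_mono * jump_abs_summable weighted_jump_summable bdd) auto
qed

text \<open>Integrating the constant 1 gives the jump component itself; on [a, b] it will turn out
  to be \<open>jump_part\<close>.\<close>

definition jump_fun :: "real \<Rightarrow> real" where "jump_fun = jump_integral (\<lambda>_. 1)"

lemma jump_fun_eq: "jump_fun x = infsum (rjump f) {..<x} + infsum (ljump f) {..x}"
  by (simp add: jump_fun_def jump_integral_def)

lemma jump_summable: "ljump f summable_on B" "rjump f summable_on B"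
  using jump_abs_summable[of B] by (auto intro: abs_summable_summable)

lemma jump_fun_diff:
  assumes "x \<le> y"
  shows "jump_fun y - jump_fun x = infsum (rjump f) {x..<y} + infsum (ljump f) {x<..y}"
  unfolding jump_fun_def using jump_integral_diff[of "\<lambda>_. 1::real", OF _ assms] by (simp add: image_constant_conv)

text \<open>The increment of \<open>jump_fun\<close> times \<open>v\<close> is an integral of the
  constant \<open>v\<close>, so the difference is the integral of \<open>v - \<gamma>\<close>. The
  bound is insensitive to where in [x, y] the jumps sit.\<close>

lemma jump_fun_cell:
  fixes \<gamma> :: "real \<Rightarrow> 'a::banach"
  assumes bdd: "bounded (range \<gamma>)" and "x \<le> y" and e: "\<And>z. z \<in> {x..y} \<Longrightarrow> norm (v - \<gamma> z) \<le> e"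
  shows "norm ((jump_fun y - jump_fun x) *\<^sub>R v - (jump_integral \<gamma> y - jump_integral \<gamma> x)) \<le> e * (jump_variation y - jump_variation x)"
proof -
  have jump_fun: "jump_fun u *\<^sub>R v = jump_integral (\<lambda>_. v) u" for u
    unfolding jump_fun_eq jump_integral_def by (simp add: scaleR_left_distrib infsum_scaleR_left jump_summable)
  have bdd': "bounded (\<gamma> ` B)" "bounded ((\<lambda>z. v - \<gamma> z) ` B)" for B
    using bounded_subset[OF bdd, of "\<gamma> ` B"] by (auto intro!: bounded_minus_comp simp: image_constant_conv)
  have Jd: "jump_integral (\<lambda>z. v - \<gamma> z) u = jump_integral (\<lambda>_. v) u - jump_integral \<gamma> u" for u
  proof -
    have "(\<Sum>\<^sub>\<infinity>z\<in>B. j z *\<^sub>R v) = (\<Sum>\<^sub>\<infinity>z\<in>B. j z *\<^sub>R (v - \<gamma> z)) + (\<Sum>\<^sub>\<infinity>z\<in>B. j z *\<^sub>R \<gamma> z)"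
      if "j = ljump f \<or> j = rjump f" for j B
      using that by (subst infsum_add[symmetric]) (auto intro!: weighted_jump_summable bdd' simp flip: scaleR_right_distrib)
    from this[of "rjump f" "{..<u}"] this[of "ljump f" "{..u}"] show ?thesis
      by (simp add: jump_integral_def)
  qed
  from norm_jump_integral_diff_le[OF bdd'(2) \<open>x \<le> y\<close> e] show ?thesis
    unfolding Jd scaleR_left_diff_distrib jump_fun by (simp add: algebra_simps)
qed

text \<open>By summability some finite \<open>Y\<close> leaves at most \<open>e / 2\<close> of the
  mass outside. Short one-sided intervals at a point, without that point, miss \<open>Y\<close>;
  this yields the one-sided limits of \<open>jump_fun\<close>.\<close>

lemma infsum_jump_mass_small:
  assumes "e > 0"
  obtains Y where "finite Y" "\<And>B. B \<inter> Y = {} \<Longrightarrow> infsum jump_mass B < e"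
proof -
  obtain Y where Y: "finite Y" "dist (sum jump_mass Y) (infsum jump_mass UNIV) \<le> e / 2"
    using infsum_finite_approximation[OF jump_mass_summable[of UNIV], of "e / 2"] assms by auto
  have "infsum jump_mass B < e" if "B \<inter> Y = {}" for B
  proof -
    have "infsum jump_mass B + sum jump_mass Y = infsum jump_mass (B \<union> Y)"
      using infsum_Un_disjoint[OF jump_mass_summable jump_mass_summable that] Y by simp
    also have "\<dots> \<le> infsum jump_mass UNIV"
      by (intro infsum_mono2 jump_mass_summable) (auto simp: jump_mass_nonneg)
    finally show ?thesis using Y(2) assms unfolding dist_real_def by linarith
  qed
  then show ?thesis using that Y by blast
qed

lemma jump_fun_tendsto_left: "(jump_fun \<longlongrightarrow> jump_fun y - ljump f y) (at_left y)"
proof (rule tendstoI)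
  fix e :: real assume "e > 0"
  then obtain Y where Y: "finite Y" "\<And>B. B \<inter> Y = {} \<Longrightarrow> infsum jump_mass B < e"
    using infsum_jump_mass_small by blast
  \<comment> \<open>\<open>Y\<close> may contain \<open>y\<close>; only its points strictly to the
    left have to be passed, since the remainder will live on \<open>{x..<y}\<close>.\<close>
  have "\<forall>\<^sub>F x in at_left y. \<forall>z\<in>Y. z < y \<longrightarrow> x > z"
    using Y(1)
  proof (intro eventually_ball_finite ballI)
    fix z assume "z \<in> Y"
    show "\<forall>\<^sub>F x in at_left y. z < y \<longrightarrow> x > z"
      using eventually_at_left_real[of z y] by (cases "z < y") (auto elim: eventually_mono)
  qed
  moreover have "\<forall>\<^sub>F x in at_left y. x < y"
    by (simp add: eventually_at_filter)
  ultimately show "\<forall>\<^sub>F x in at_left y. dist (jump_fun x) (jump_fun y - ljump f y) < e"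
  proof eventually_elim
    case (elim x)
    have "jump_fun y - jump_fun x = infsum (rjump f) {x..<y} + infsum (ljump f) {x<..y}"
      using elim by (intro jump_fun_diff) simp
    \<comment> \<open>The left jump at \<open>y\<close> is present for every \<open>x < y\<close>
      and is the one term that survives in the limit.\<close>
    also have "{x<..y} = {x<..<y} \<union> {y}" using elim by auto
    also have "infsum (ljump f) \<dots> = infsum (ljump f) {x<..<y} + ljump f y"
      by (subst infsum_Un_disjoint) (auto simp: jump_summable)
    finally have "\<bar>jump_fun y - ljump f y - jump_fun x\<bar> \<le> \<bar>infsum (rjump f) {x..<y}\<bar> + \<bar>infsum (ljump f) {x<..<y}\<bar>"
      by linarith
    also have "\<dots> \<le> (\<Sum>\<^sub>\<infinity>z\<in>{x..<y}. \<bar>rjump f z\<bar>) + (\<Sum>\<^sub>\<infinity>z\<in>{x<..<y}. \<bar>ljump f z\<bar>)"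
      using norm_infsum_bound[of "rjump f" "{x..<y}"] norm_infsum_bound[of "ljump f" "{x<..<y}"] jump_abs_summable
      by (intro add_mono) auto
    also have "\<dots> \<le> (\<Sum>\<^sub>\<infinity>z\<in>{x..<y}. \<bar>rjump f z\<bar>) + (\<Sum>\<^sub>\<infinity>z\<in>{x..<y}. \<bar>ljump f z\<bar>)"
      by (intro add_mono infsum_mono2 jump_abs_summable) auto
    also have "\<dots> = infsum jump_mass {x..<y}"
      unfolding jump_mass_def by (subst infsum_add) (auto simp: jump_abs_summable)
    also have "\<dots> < e"
      by (rule Y(2)) (use elim in fastforce)
    finally show ?case by (simp add: dist_real_def)
  qed
qed

lemma jump_fun_tendsto_right: "(jump_fun \<longlongrightarrow> jump_fun y + rjump f y) (at_right y)"
proof (rule tendstoI)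
  fix e :: real assume "e > 0"
  then obtain Y where Y: "finite Y" "\<And>B. B \<inter> Y = {} \<Longrightarrow> infsum jump_mass B < e"
    using infsum_jump_mass_small by blast
  have "\<forall>\<^sub>F x in at_right y. \<forall>z\<in>Y. y < z \<longrightarrow> x < z"
    using Y(1)
  proof (intro eventually_ball_finite ballI)
    fix z assume "z \<in> Y"
    show "\<forall>\<^sub>F x in at_right y. y < z \<longrightarrow> x < z"
      using eventually_at_right_real[of y z] by (cases "y < z") (auto elim: eventually_mono)
  qed
  moreover have "\<forall>\<^sub>F x in at_right y. y < x"
    by (simp add: eventually_at_filter)
  ultimately show "\<forall>\<^sub>F x in at_right y. dist (jump_fun x) (jump_fun y + rjump f y) < e"
  proof eventually_elim
    case (elim x)
    have "jump_fun x - jump_fun y = infsum (rjump f) {y..<x} + infsum (ljump f) {y<..x}"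
      using elim by (intro jump_fun_diff) simp
    \<comment> \<open>On this side the surviving term is the right jump at \<open>y\<close>, at the
      closed end of the range.\<close>
    also have "{y..<x} = {y<..<x} \<union> {y}" using elim by auto
    also have "infsum (rjump f) \<dots> = infsum (rjump f) {y<..<x} + rjump f y"
      by (subst infsum_Un_disjoint) (auto simp: jump_summable)
    finally have "\<bar>jump_fun x - (jump_fun y + rjump f y)\<bar> \<le> \<bar>infsum (rjump f) {y<..<x}\<bar> + \<bar>infsum (ljump f) {y<..x}\<bar>"
      by linarith
    also have "\<dots> \<le> (\<Sum>\<^sub>\<infinity>z\<in>{y<..<x}. \<bar>rjump f z\<bar>) + (\<Sum>\<^sub>\<infinity>z\<in>{y<..x}. \<bar>ljump f z\<bar>)"
      using norm_infsum_bound[of "rjump f" "{y<..<x}"] norm_infsum_bound[of "ljump f" "{y<..x}"] jump_abs_summable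
      by (intro add_mono) auto
    also have "\<dots> \<le> (\<Sum>\<^sub>\<infinity>z\<in>{y<..x}. \<bar>rjump f z\<bar>) + (\<Sum>\<^sub>\<infinity>z\<in>{y<..x}. \<bar>ljump f z\<bar>)"
      by (intro add_mono infsum_mono2 jump_abs_summable) auto
    also have "\<dots> = infsum jump_mass {y<..x}"
      unfolding jump_mass_def by (subst infsum_add) (auto simp: jump_abs_summable)
    also have "\<dots> < e"
      by (rule Y(2)) (use elim in fastforce)
    finally show ?case by (simp add: dist_real_def)
  qed
qed

end

section \<open>Transfer from the real line to a compact interval\<close>

definition clip :: "real \<Rightarrow> real \<Rightarrow> real \<Rightarrow> real" where
  "clip a b x = max a (min b x)"

lemma clip_in: "a \<le> b \<Longrightarrow> clip a b x \<in> {a..b}"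
  by (auto simp: clip_def)

lemma clip_id: "x \<in> {a..b} \<Longrightarrow> clip a b x = x"
  by (auto simp: clip_def)

lemma clip_mono: "x \<le> y \<Longrightarrow> clip a b x \<le> clip a b y"
  by (auto simp: clip_def)

lemma clip_le: "a \<le> b \<Longrightarrow> x \<le> a \<Longrightarrow> clip a b x = a"
  by (auto simp: clip_def)

lemma clip_ge: "a \<le> b \<Longrightarrow> b \<le> x \<Longrightarrow> clip a b x = b"
  by (auto simp: clip_def)

lemma at_within_Ico_eq_at_left: "a < x \<Longrightarrow> at x within {a..<x} = at_left (x::real)"
  by (rule at_within_nhd[of _ "{a<..}"]) auto

lemma at_within_Ioc_eq_at_right: "x < b \<Longrightarrow> at x within {x<..b} = at_right (x::real)"
  by (rule at_within_nhd[of _ "{..<b}"]) auto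

text \<open>Agreement is asked only on [a, x), so \<open>F\<close> can be the constant extension of
  \<open>f\<close>, or \<open>jump_fun\<close>, whose limits on the line are known.\<close>

lemma left_lim_eqI:
  assumes "a < x" "\<And>z. z \<in> {a..<x} \<Longrightarrow> f z = F z" "(F \<longlongrightarrow> l) (at_left x)"
  shows "left_lim a f x = l"
proof -
  have "\<forall>\<^sub>F z in at x within {a..<x}. F z = f z"
    using assms(2) by (simp add: eventually_at_filter)
  then have "(f \<longlongrightarrow> l) (at x within {a..<x})"
    using assms(3) unfolding at_within_Ico_eq_at_left[OF assms(1)] by (rule Lim_transform_eventually[rotated])
  then show ?thesis
    unfolding left_lim_def at_within_Ico_eq_at_left[OF assms(1)] by (simp add: tendsto_Lim)
qed

lemma right_lim_eqI:
  assumes "x < b" "\<And>z. z \<in> {x<..b} \<Longrightarrow> f z = F z" "(F \<longlongrightarrow> l) (at_right x)"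
  shows "right_lim b f x = l"
proof -
  have "\<forall>\<^sub>F z in at x within {x<..b}. F z = f z"
    using assms(2) by (simp add: eventually_at_filter)
  then have "(f \<longlongrightarrow> l) (at x within {x<..b})"
    using assms(3) unfolding at_within_Ioc_eq_at_right[OF assms(1)] by (rule Lim_transform_eventually[rotated])
  then show ?thesis
    unfolding right_lim_def at_within_Ioc_eq_at_right[OF assms(1)] by (simp add: tendsto_Lim)
qed

text \<open>Extending \<open>f\<close> by constants outside \<open>[a, b]\<close> makes the one-sided jumps that do not exist
  at the end points equal to \<open>0\<close>.\<close>
locale controlled_Icc =
  fixes a b :: real and f A :: "real \<Rightarrow> real"
  assumes ab: "a < b" and control_Icc: "controls_on {a..b} A f"
begin

sublocale controlled "\<lambda>x. f (clip a b x)" "\<lambda>x. A (clip a b x)" "A b - A a"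
proof
  show "controls_on UNIV (\<lambda>x. A (clip a b x)) (\<lambda>x. f (clip a b x))"
    using control_Icc clip_in[of a b] clip_mono ab by (auto simp: controls_on_def)
  show "A (clip a b y) - A (clip a b x) \<le> A b - A a" for x y
    using clip_in[of a b x] clip_in[of a b y] ab
      controls_on_mono[OF control_Icc, of "clip a b y" b] controls_on_mono[OF control_Icc, of a "clip a b x"]
    by auto
qed

abbreviation lj :: "real \<Rightarrow> real" where "lj \<equiv> ljump (\<lambda>x. f (clip a b x))"
abbreviation rj :: "real \<Rightarrow> real" where "rj \<equiv> rjump (\<lambda>x. f (clip a b x))"

text \<open>The extension is constant just to the left of \<open>x\<close> when
  \<open>x \<le> a\<close> or \<open>x > b\<close>; at \<open>b\<close> itself a genuine left jump
  may remain.\<close>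

lemma lj_eq_0: "x \<notin> {a<..b} \<Longrightarrow> lj x = 0"
proof -
  assume x: "x \<notin> {a<..b}"
  have "\<forall>\<^sub>F z in at_left x. f (clip a b x) = f (clip a b z)"
  proof (cases "x \<le> a")
    case True
    then show ?thesis
      using ab by (auto simp: eventually_at_filter clip_le)
  next
    case False
    then have "b < x" using x by auto
    show ?thesis
      using eventually_at_left_real[OF \<open>b < x\<close>]
      by eventually_elim (use \<open>b < x\<close> ab in \<open>auto simp: clip_ge\<close>)
  qed
  then have "((\<lambda>x. f (clip a b x)) \<longlongrightarrow> f (clip a b x)) (at_left x)"
    by (rule tendsto_eventually[OF eventually_mono]) simp
  then show ?thesis by (simp add: ljump_eqI)
qed

lemma rj_eq_0: "x \<notin> {a..<b} \<Longrightarrow> rj x = 0"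
proof -
  assume x: "x \<notin> {a..<b}"
  have "\<forall>\<^sub>F z in at_right x. f (clip a b x) = f (clip a b z)"
  proof (cases "b \<le> x")
    case True
    then show ?thesis
      using ab by (auto simp: eventually_at_filter clip_ge)
  next
    case False
    then have "x < a" using x by auto
    show ?thesis
      using eventually_at_right_real[OF \<open>x < a\<close>]
      by eventually_elim (use \<open>x < a\<close> ab in \<open>auto simp: clip_le\<close>)
  qed
  then have "((\<lambda>x. f (clip a b x)) \<longlongrightarrow> f (clip a b x)) (at_right x)"
    by (rule tendsto_eventually[OF eventually_mono]) simp
  then show ?thesis by (simp add: rjump_eqI)
qed

lemma left_lim_eq: "x \<in> {a<..b} \<Longrightarrow> left_lim a f x = f x - lj x"
  using ljump_tendsto(1)[of x] by (intro left_lim_eqI) (auto simp: clip_id)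

lemma right_lim_eq: "x \<in> {a..<b} \<Longrightarrow> right_lim b f x = f x + rj x"
  using rjump_tendsto(1)[of x] by (intro right_lim_eqI) (auto simp: clip_id)

text \<open>Both sides contain the same jumps, grouped differently: \<open>jump_part\<close>
  isolates the right jump at \<open>a\<close> and the left jump at \<open>x\<close> and pairs the
  two jumps at each point between, while \<open>jump_fun\<close> sums each side separately.\<close>

lemma jump_part_eq:
  assumes x: "x \<in> {a..b}"
  shows "jump_part a b f x = jump_fun x"
proof (cases "x = a")
  case True
  have "infsum rj {..<a} = 0" "infsum lj {..a} = 0"
    by (rule infsum_0; auto simp: rj_eq_0 lj_eq_0)+
  then show ?thesis
    using True by (simp add: jump_part_def jump_fun_eq)
next
  case False
  then have ax: "a < x" using x by simp
  have "infsum rj {..<x} = infsum rj ({a} \<union> {a<..<x})"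
    using ax by (intro infsum_cong_neutral) (auto simp: rj_eq_0)
  also have "\<dots> = rj a + infsum rj {a<..<x}"
    by (subst infsum_Un_disjoint) (auto simp: jump_summable)
  finally have 1: "infsum rj {..<x} = rj a + infsum rj {a<..<x}" .
  have "infsum lj {..x} = infsum lj ({x} \<union> {a<..<x})"
    using ax by (intro infsum_cong_neutral) (auto simp: lj_eq_0)
  also have "\<dots> = lj x + infsum lj {a<..<x}"
    by (subst infsum_Un_disjoint) (auto simp: jump_summable)
  finally have 2: "infsum lj {..x} = lj x + infsum lj {a<..<x}" .
  have "(\<Sum>\<^sub>\<infinity>y\<in>{a<..<x}. right_lim b f y - left_lim a f y) = (\<Sum>\<^sub>\<infinity>y\<in>{a<..<x}. rj y + lj y)"
    using x by (intro infsum_cong) (auto simp: left_lim_eq right_lim_eq)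
  also have "\<dots> = infsum rj {a<..<x} + infsum lj {a<..<x}"
    by (intro infsum_add jump_summable)
  finally show ?thesis
    using ax x ab 1 2 by (simp add: jump_part_def jump_fun_eq left_lim_eq right_lim_eq)
qed

lemma left_lim_jump_part: "x \<in> {a<..b} \<Longrightarrow> left_lim a (jump_part a b f) x = jump_part a b f x - lj x"
  using jump_fun_tendsto_left[of x] by (intro left_lim_eqI) (auto simp: jump_part_eq)

lemma right_lim_jump_part: "x \<in> {a..<b} \<Longrightarrow> right_lim b (jump_part a b f) x = jump_part a b f x + rj x"
  using jump_fun_tendsto_right[of x] by (intro right_lim_eqI) (auto simp: jump_part_eq)

text \<open>The convention of \<open>jump_at\<close> at the end points is that of the constant
  extension, for which \<open>lj a\<close> and \<open>rj b\<close> vanish.\<close>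

lemma jump_at_eq:
  assumes "x \<in> {a..b}"
  shows "jump_at a b (jump_part a b f) x = lj x + rj x"
proof -
  have "(if x = b then jump_part a b f b else right_lim b (jump_part a b f) x) = jump_part a b f x + rj x"
    using assms right_lim_jump_part[of x] rj_eq_0[of b] by auto
  moreover have "(if x = a then jump_part a b f a else left_lim a (jump_part a b f) x) = jump_part a b f x - lj x"
    using assms left_lim_jump_part[of x] lj_eq_0[of a] by auto
  ultimately show ?thesis
    by (simp add: jump_at_def)
qed

text \<open>Continuity makes each one-sided jump 0. Only the sum is recorded because it is the
  weight in the series; at a discontinuity whose two jumps cancel this weight is 0 as well.\<close>

lemma continuous_jump_part_imp:
  assumes x: "x \<in> {a..b}" and cont: "continuous (at x within {a..b}) (jump_part a b f)"
  shows "lj x + rj x = 0"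
proof -
  have lim: "(jump_part a b f \<longlongrightarrow> jump_part a b f x) (at x within {a..b})"
    using cont by (simp add: continuous_within)
  have "lj x = 0"
  proof (cases "x = a")
    case False
    then have "a < x" using x by simp
    have "(jump_part a b f \<longlongrightarrow> jump_part a b f x) (at x within {a..<x})"
      using x by (intro tendsto_within_subset[OF lim]) auto
    then have "left_lim a (jump_part a b f) x = jump_part a b f x"
      unfolding at_within_Ico_eq_at_left[OF \<open>a < x\<close>] using \<open>a < x\<close> by (intro left_lim_eqI) auto
    then show ?thesis using left_lim_jump_part[of x] \<open>a < x\<close> x by simp
  qed (simp add: lj_eq_0)
  moreover have "rj x = 0"
  proof (cases "x = b")
    case False
    then have "x < b" using x by simp
    have "(jump_part a b f \<longlongrightarrow> jump_part a b f x) (at x within {x<..b})"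
      using x by (intro tendsto_within_subset[OF lim]) auto
    then have "right_lim b (jump_part a b f) x = jump_part a b f x"
      unfolding at_within_Ioc_eq_at_right[OF \<open>x < b\<close>] using \<open>x < b\<close> by (intro right_lim_eqI) auto
    then show ?thesis using right_lim_jump_part[of x] \<open>x < b\<close> x by simp
  qed (simp add: rj_eq_0)
  ultimately show ?thesis by simp
qed

text \<open>The two jumps at a point multiply the same \<open>\<gamma> z\<close> and merge into the
  total jump. Points of continuity have weight 0, and the injective enumeration lists each remaining
  point once.\<close>

lemma jump_integral_eq_infsum_jumps:
  fixes \<gamma> :: "real \<Rightarrow> 'a::banach"
  assumes bdd: "bounded (range \<gamma>)"
    and inj: "inj_on \<theta> K"
    and disc: "{x \<in> {a..b}. \<not> continuous (at x within {a..b}) (jump_part a b f)} = \<theta> ` K"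
    and h: "\<And>k. k \<in> K \<Longrightarrow> h k = jump_at a b (jump_part a b f) (\<theta> k)"
  shows "jump_integral \<gamma> b - jump_integral \<gamma> a = (\<Sum>\<^sub>\<infinity>k\<in>K. h k *\<^sub>R \<gamma> (\<theta> k))"
proof -
  have \<theta>: "\<theta> k \<in> {a..b}" if "k \<in> K" for k
    using disc that by blast
  have bdd': "bounded (\<gamma> ` B)" for B
    by (rule bounded_subset[OF bdd]) auto
  have "jump_integral \<gamma> b - jump_integral \<gamma> a = (\<Sum>\<^sub>\<infinity>z\<in>{a..<b}. rj z *\<^sub>R \<gamma> z) + (\<Sum>\<^sub>\<infinity>z\<in>{a<..b}. lj z *\<^sub>R \<gamma> z)"
    using ab by (intro jump_integral_diff bdd) simp
  also have "(\<Sum>\<^sub>\<infinity>z\<in>{a..<b}. rj z *\<^sub>R \<gamma> z) = (\<Sum>\<^sub>\<infinity>z\<in>{a..b}. rj z *\<^sub>R \<gamma> z)"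
    by (rule infsum_cong_neutral) (auto simp: rj_eq_0)
  also have "(\<Sum>\<^sub>\<infinity>z\<in>{a<..b}. lj z *\<^sub>R \<gamma> z) = (\<Sum>\<^sub>\<infinity>z\<in>{a..b}. lj z *\<^sub>R \<gamma> z)"
    by (rule infsum_cong_neutral) (auto simp: lj_eq_0)
  also have "(\<Sum>\<^sub>\<infinity>z\<in>{a..b}. rj z *\<^sub>R \<gamma> z) + (\<Sum>\<^sub>\<infinity>z\<in>{a..b}. lj z *\<^sub>R \<gamma> z)
      = (\<Sum>\<^sub>\<infinity>z\<in>{a..b}. (lj z + rj z) *\<^sub>R \<gamma> z)"
    by (subst infsum_add[symmetric])
       (auto intro!: weighted_jump_summable bdd' simp: scaleR_left_distrib add.commute)
  also have "\<dots> = (\<Sum>\<^sub>\<infinity>z\<in>\<theta> ` K. (lj z + rj z) *\<^sub>R \<gamma> z)"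
    using \<theta> disc by (intro infsum_cong_neutral) (auto simp: continuous_jump_part_imp)
  also have "\<dots> = (\<Sum>\<^sub>\<infinity>k\<in>K. (lj (\<theta> k) + rj (\<theta> k)) *\<^sub>R \<gamma> (\<theta> k))"
    using infsum_reindex[OF inj, of "\<lambda>z. (lj z + rj z) *\<^sub>R \<gamma> z"] by (simp add: o_def)
  also have "\<dots> = (\<Sum>\<^sub>\<infinity>k\<in>K. h k *\<^sub>R \<gamma> (\<theta> k))"
    using \<theta> by (intro infsum_cong) (simp add: h jump_at_eq)
  finally show ?thesis .
qed

text \<open>The cell estimates of \<open>jump_fun_cell\<close> add up to \<open>e\<close> times the
  total jump variation, which is bounded by the increase of \<open>A\<close>. Jumps that coincide
  with nodes cause no extra error.\<close>

lemma jump_part_uniform_sum_close: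
  fixes \<gamma> :: "real \<Rightarrow> 'a::banach"
  assumes \<gamma>: "continuous_on {a..b} \<gamma>" and d: "d > 0" and n: "n > 0" "(b - a) / n < d"
    and close: "\<And>x y. x \<in> {a..b} \<Longrightarrow> y \<in> {a..b} \<Longrightarrow> \<bar>x - y\<bar> < d \<Longrightarrow> norm (\<gamma> x - \<gamma> y) \<le> e"
    and inj: "inj_on \<theta> K"
    and disc: "{x \<in> {a..b}. \<not> continuous (at x within {a..b}) (jump_part a b f)} = \<theta> ` K"
    and h: "\<And>k. k \<in> K \<Longrightarrow> h k = jump_at a b (jump_part a b f) (\<theta> k)"
  shows "norm (uniform_sum a b n \<gamma> (jump_part a b f) - (\<Sum>\<^sub>\<infinity>k\<in>K. h k *\<^sub>R \<gamma> (\<theta> k))) \<le> e * (A b - A a)"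
proof -
  \<comment> \<open>Clipping makes the integrand bounded on the whole line, as the jump integral
    requires.\<close>
  define \<gamma>' where "\<gamma>' = (\<lambda>x. \<gamma> (clip a b x))"
  have "bounded (\<gamma> ` {a..b})"
    using \<gamma> by (intro compact_imp_bounded compact_continuous_image) auto
  then have bdd: "bounded (range \<gamma>')"
    by (rule bounded_subset) (use ab clip_in[of a b] in \<open>auto simp: \<gamma>'_def\<close>)
  have "(\<Sum>\<^sub>\<infinity>k\<in>K. h k *\<^sub>R \<gamma> (\<theta> k)) = (\<Sum>\<^sub>\<infinity>k\<in>K. h k *\<^sub>R \<gamma>' (\<theta> k))"
  proof (rule infsum_cong)
    fix k assume "k \<in> K"
    then have "\<theta> k \<in> {a..b}" using disc by blast
    then show "h k *\<^sub>R \<gamma> (\<theta> k) = h k *\<^sub>R \<gamma>' (\<theta> k)" by (simp add: \<gamma>'_def clip_id)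
  qed
  also have "\<dots> = jump_integral \<gamma>' b - jump_integral \<gamma>' a"
    using jump_integral_eq_infsum_jumps[OF bdd inj disc h] by simp
  finally have sum: "(\<Sum>\<^sub>\<infinity>k\<in>K. h k *\<^sub>R \<gamma> (\<theta> k)) = jump_integral \<gamma>' b - jump_integral \<gamma>' a" .
  note u = uniform_tagged_partition[OF n(1) ab]
  have "norm (RS_sum \<gamma> (jump_part a b f) (map (uniform_node a b n) [0..<Suc n]) (map (uniform_node a b n) [0..<n])
      - (jump_integral \<gamma>' b - jump_integral \<gamma>' a)) \<le> e * jump_variation b - e * jump_variation a"
  proof (rule RS_sum_close[OF u(1)])
    show "mesh (map (uniform_node a b n) [0..<Suc n]) < d"
      unfolding u(2) by (rule n(2))
    fix x t y assume xty: "a \<le> x" "x \<le> t" "t \<le> y" "y \<le> b" "y - x < d"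
    have "norm ((jump_fun y - jump_fun x) *\<^sub>R \<gamma> t - (jump_integral \<gamma>' y - jump_integral \<gamma>' x)) \<le> e * (jump_variation y - jump_variation x)"
      using xty by (intro jump_fun_cell bdd) (auto simp: \<gamma>'_def clip_id intro!: close)
    then show "norm ((jump_part a b f y - jump_part a b f x) *\<^sub>R \<gamma> t - (jump_integral \<gamma>' y - jump_integral \<gamma>' x)) \<le> e * jump_variation y - e * jump_variation x"
      using xty by (simp add: jump_part_eq right_diff_distrib)
  qed
  \<comment> \<open>Taking both arguments of \<open>close\<close> equal to \<open>a\<close> shows
    that \<open>e\<close> is nonnegative.\<close>
  also have "\<dots> \<le> e * (A b - A a)"
    unfolding right_diff_distrib[symmetric] using close[of a a] d ab
    by (intro mult_left_mono jump_variation_diff_le_V) auto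
  finally show ?thesis unfolding u(3) sum .
qed

end

section \<open>Continuity of the delay functional\<close>

lemma RS_integral_approx:
  fixes \<xi> \<gamma> :: "real \<Rightarrow> 'a::banach"
  assumes bv: "bounded_variation_on a b f" "total_variation a b f \<le> V" and ab: "a < b"
    and \<xi>: "continuous_on {a..b} \<xi>" and \<gamma>: "continuous_on {a..b} \<gamma>"
    and d: "d > 0" and n: "n > 0" "(b - a) / n < d / 2"
    and modulus: "\<And>x y. x \<in> {a..b} \<Longrightarrow> y \<in> {a..b} \<Longrightarrow> \<bar>x - y\<bar> < d \<Longrightarrow> norm (\<gamma> x - \<gamma> y) \<le> e"
    and close: "\<And>x. x \<in> {a..b} \<Longrightarrow> norm (\<xi> x - \<gamma> x) \<le> e"
    and inj: "inj_on \<theta> K"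
    and disc: "{x \<in> {a..b}. \<not> continuous (at x within {a..b}) (jump_part a b f)} = \<theta> ` K"
    and h: "\<And>k. k \<in> K \<Longrightarrow> h k = jump_at a b (jump_part a b f) (\<theta> k)"
  shows "norm (RS_integral a b \<xi> f - (uniform_sum a b n \<gamma> (cont_part a b f) + (\<Sum>\<^sub>\<infinity>k\<in>K. h k *\<^sub>R \<gamma> (\<theta> k))))
    \<le> 3 * e * V"
proof -
  obtain A where A: "controls_on {a..b} A f" and AV: "A b - A a \<le> V"
    using bounded_variation_control[OF bv(1) ab] bv(2) by (metis order_trans)
  interpret controlled_Icc a b f A
    using A ab by unfold_locales
  let ?T = "\<Sum>\<^sub>\<infinity>k\<in>K. h k *\<^sub>R \<gamma> (\<theta> k)"
  have "norm (\<xi> x - \<gamma> y) \<le> 2 * e" if "x \<in> {a..b}" "y \<in> {a..b}" "\<bar>x - y\<bar> < d" for x y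
    using norm_diff_triangle_le[OF close[OF that(1)] modulus[OF that]] by simp
  then have 1: "norm (RS_integral a b \<xi> f - uniform_sum a b n \<gamma> f) \<le> 2 * e * (A b - A a)"
    by (rule RS_integral_uniform_sum_close[OF A ab \<xi> n])
  have "(b - a) / n < d" using n(2) d by linarith
  then have 2: "norm (uniform_sum a b n \<gamma> (jump_part a b f) - ?T) \<le> e * (A b - A a)"
    using modulus inj disc h by (intro jump_part_uniform_sum_close[OF \<gamma> d n(1)])
  have split: "uniform_sum a b n \<gamma> f = uniform_sum a b n \<gamma> (cont_part a b f) + uniform_sum a b n \<gamma> (jump_part a b f)"
    unfolding uniform_sum_def sum.distrib[symmetric] scaleR_left_distrib[symmetric]
    by (simp add: cont_part_def)
  have "RS_integral a b \<xi> f - (uniform_sum a b n \<gamma> (cont_part a b f) + ?T)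
      = (RS_integral a b \<xi> f - uniform_sum a b n \<gamma> f) + (uniform_sum a b n \<gamma> (jump_part a b f) - ?T)"
    unfolding split by simp
  also have "norm \<dots> \<le> 2 * e * (A b - A a) + e * (A b - A a)"
    by (rule norm_triangle_mono[OF 1 2])
  also have "\<dots> = 3 * e * (A b - A a)"
    by (simp add: algebra_simps)
  also have "\<dots> \<le> 3 * e * V"
    using AV order_trans[OF norm_ge_zero modulus[of a a]] ab d by (intro mult_left_mono) auto
  finally show ?thesis .
qed

section \<open>Supremum norm, neighbourhoods in C, and limits of series\<close>

lemma norm_le_normC:
  assumes "\<phi> \<in> Cspace r" "\<theta> \<in> {-r..0}"
  shows "norm (\<phi> \<theta>) \<le> normC r \<phi>"
  unfolding normC_def
proof (rule cSUP_upper[OF assms(2)])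
  have "compact ((\<lambda>\<theta>. norm (\<phi> \<theta>)) ` {-r..0})"
    using assms(1) by (intro compact_continuous_image continuous_intros) (auto simp: Cspace_def)
  then show "bdd_above ((\<lambda>\<theta>. norm (\<phi> \<theta>)) ` {-r..0})"
    by (intro bounded_imp_bdd_above compact_imp_bounded)
qed

lemma Cspace_diff: "\<phi> \<in> Cspace r \<Longrightarrow> \<psi> \<in> Cspace r \<Longrightarrow> (\<lambda>\<theta>. \<phi> \<theta> - \<psi> \<theta>) \<in> Cspace r"
  by (auto simp: Cspace_def intro: continuous_intros)

lemma norm_diff_le_normC:
  assumes "\<phi> \<in> Cspace r" "\<psi> \<in> Cspace r" "\<theta> \<in> {-r..0}"
  shows "norm (\<phi> \<theta> - \<psi> \<theta>) \<le> normC r (\<lambda>\<theta>. \<phi> \<theta> - \<psi> \<theta>)"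
  using norm_le_normC[OF Cspace_diff[OF assms(1,2)] assms(3)] .

lemma normC_le_add:
  assumes "r \<ge> 0" "\<phi> \<in> Cspace r" "\<psi> \<in> Cspace r"
  shows "normC r \<phi> \<le> normC r (\<lambda>\<theta>. \<phi> \<theta> - \<psi> \<theta>) + normC r \<psi>"
  unfolding normC_def[of r \<phi>]
proof (rule cSUP_least)
  fix \<theta> assume "\<theta> \<in> {-r..0}"
  from norm_diff_le_normC[OF assms(2,3) this] norm_le_normC[OF assms(3) this]
  show "norm (\<phi> \<theta>) \<le> normC r (\<lambda>\<theta>. \<phi> \<theta> - \<psi> \<theta>) + normC r \<psi>"
    using norm_triangle_ineq2[of "\<phi> \<theta>" "\<psi> \<theta>"] by linarith
qed (use assms in auto)

text \<open>Elements of C are plain functions singled out by \<open>Cspace\<close>, so the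
  neighbourhoods of a point are encoded as a filter, and \<open>contRC\<close> becomes a limit
  statement. The filter is not punctured; this is consistent because the limit sought is the value
  at the point.\<close>

definition nearC :: "real \<Rightarrow> real \<Rightarrow> (real \<Rightarrow> 'a::real_normed_vector) \<Rightarrow> (real \<times> (real \<Rightarrow> 'a)) filter" where
  "nearC r t \<psi> = (INF d\<in>{0<..}. principal
     {(s, \<phi>). \<phi> \<in> Cspace r \<and> \<bar>s - t\<bar> < d \<and> normC r (\<lambda>\<theta>. \<phi> \<theta> - \<psi> \<theta>) < d})"

lemma eventually_nearC:
  "eventually P (nearC r t \<psi>) \<longleftrightarrow> (\<exists>d>0. \<forall>s. \<forall>\<phi>\<in>Cspace r.
     \<bar>s - t\<bar> < d \<and> normC r (\<lambda>\<theta>. \<phi> \<theta> - \<psi> \<theta>) < d \<longrightarrow> P (s, \<phi>))"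
  unfolding nearC_def
  by (subst eventually_INF_base)
     (auto simp: eventually_principal intro: exI[of _ "min _ _"] intro!: bexI[of _ "min _ _"])

lemma contRC_iff_tendsto:
  "contRC r f \<longleftrightarrow> (\<forall>t. \<forall>\<psi>\<in>Cspace r. ((\<lambda>x. f (fst x) (snd x)) \<longlongrightarrow> f t \<psi>) (nearC r t \<psi>))"
  by (simp add: contRC_def tendsto_iff eventually_nearC)

lemma contRC_tendsto:
  "contRC r f \<Longrightarrow> \<psi> \<in> Cspace r \<Longrightarrow> ((\<lambda>x. f (fst x) (snd x)) \<longlongrightarrow> f t \<psi>) (nearC r t \<psi>)"
  by (simp add: contRC_iff_tendsto)

lemma eventually_nearC_Cspace: "\<forall>\<^sub>F x in nearC r t \<psi>. snd x \<in> Cspace r"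
  unfolding eventually_nearC by (auto intro: exI[of _ 1])

lemma eventually_nearC_close:
  "d > 0 \<Longrightarrow> \<forall>\<^sub>F x in nearC r t \<psi>. \<bar>fst x - t\<bar> < d \<and> normC r (\<lambda>\<theta>. snd x \<theta> - \<psi> \<theta>) < d"
  unfolding eventually_nearC by (auto intro: exI[of _ d])

lemma tendsto_fst_nearC: "(fst \<longlongrightarrow> t) (nearC r t \<psi>)"
proof (rule tendstoI)
  fix e :: real assume "e > 0"
  from eventually_nearC_close[OF this, of t r \<psi>] show "\<forall>\<^sub>F x in nearC r t \<psi>. dist (fst x) t < e"
    by eventually_elim (simp add: dist_real_def)
qed

lemma tendsto_snd_nearC:
  assumes "\<psi> \<in> Cspace r" "\<theta> \<in> {-r..0}"
  shows "((\<lambda>x. snd x \<theta>) \<longlongrightarrow> \<psi> \<theta>) (nearC r t \<psi>)"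
proof (rule tendstoI)
  fix e :: real assume "e > 0"
  from eventually_nearC_close[OF this, of t r \<psi>] eventually_nearC_Cspace[of r t \<psi>]
  show "\<forall>\<^sub>F x in nearC r t \<psi>. dist (snd x \<theta>) (\<psi> \<theta>) < e"
    by eventually_elim (use norm_diff_le_normC[OF _ assms] in \<open>fastforce simp: dist_norm\<close>)
qed

lemma eventually_nearC_bounded:
  assumes "r \<ge> 0" "\<psi> \<in> Cspace r" "\<bar>t\<bar> < M" "normC r \<psi> < M"
  shows "\<forall>\<^sub>F x in nearC r t \<psi>. \<bar>fst x\<bar> \<le> M \<and> normC r (snd x) \<le> M"
proof -
  have "min (M - \<bar>t\<bar>) (M - normC r \<psi>) > 0" using assms by simp
  from eventually_nearC_close[OF this, of t r \<psi>] eventually_nearC_Cspace[of r t \<psi>]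
  show ?thesis
    by eventually_elim (use normC_le_add[OF assms(1) _ assms(2)] in fastforce)
qed

text \<open>The finite set \<open>F\<close> is chosen before the limit is taken, so convergence of
  finitely many terms suffices; they and the two tails account for \<open>e / 3\<close>
  each.\<close>

lemma tendsto_infsum_uniform_tail:
  fixes u :: "'k \<Rightarrow> 'x \<Rightarrow> 'a::banach"
  assumes lim: "\<And>k. k \<in> K \<Longrightarrow> (u k \<longlongrightarrow> l k) N"
    and sl: "l summable_on K" and su: "\<forall>\<^sub>F x in N. (\<lambda>k. u k x) summable_on K"
    and tail: "\<And>e. e > 0 \<Longrightarrow> \<exists>F. finite F \<and> F \<subseteq> K \<and> norm (infsum l (K - F)) \<le> e \<and>
        (\<forall>\<^sub>F x in N. norm (\<Sum>\<^sub>\<infinity>k\<in>K - F. u k x) \<le> e)"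
  shows "((\<lambda>x. \<Sum>\<^sub>\<infinity>k\<in>K. u k x) \<longlongrightarrow> infsum l K) N"
proof (rule tendstoI)
  fix e :: real assume "e > 0"
  then have e3: "e / 3 > 0" by simp
  from tail[OF this] obtain F where F: "finite F" "F \<subseteq> K" "norm (infsum l (K - F)) \<le> e / 3"
    "\<forall>\<^sub>F x in N. norm (\<Sum>\<^sub>\<infinity>k\<in>K - F. u k x) \<le> e / 3" by blast
  have split: "infsum j K = sum j F + infsum j (K - F)" if "j summable_on K" for j :: "'k \<Rightarrow> 'a"
    using infsum_Un_disjoint[of j F "K - F"] summable_on_subset_banach[OF that, of "K - F"] F(1,2)
    by (simp add: Un_absorb1)
  have "((\<lambda>x. \<Sum>k\<in>F. u k x) \<longlongrightarrow> sum l F) N"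
    using F(2) by (intro tendsto_sum lim) auto
  then have "\<forall>\<^sub>F x in N. dist (\<Sum>k\<in>F. u k x) (sum l F) < e / 3"
    using e3 by (rule tendstoD)
  with F(4) su show "\<forall>\<^sub>F x in N. dist (\<Sum>\<^sub>\<infinity>k\<in>K. u k x) (infsum l K) < e"
  proof eventually_elim
    case (elim x)
    have "(\<Sum>\<^sub>\<infinity>k\<in>K. u k x) - infsum l K
        = ((\<Sum>k\<in>F. u k x) - sum l F) + ((\<Sum>\<^sub>\<infinity>k\<in>K - F. u k x) - infsum l (K - F))"
      by (simp add: split[OF elim(2)] split[OF sl])
    also have "norm \<dots> \<le> norm ((\<Sum>k\<in>F. u k x) - sum l F)
        + (norm (\<Sum>\<^sub>\<infinity>k\<in>K - F. u k x) + norm (infsum l (K - F)))"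
      by (intro norm_triangle_le add_left_mono norm_triangle_ineq4)
    also have "\<dots> < e"
      using elim(1,3) F(3) by (simp add: dist_norm)
    finally show ?case by (simp add: dist_norm)
  qed
qed

text \<open>Continuity of \<open>\<gamma>\<close> lets each term converge while its jump point
  moves, and boundedness of \<open>\<gamma>\<close> on [-r, 0] passes the uniform smallness of the
  tails of \<open>h\<close> on to the weighted series.\<close>

lemma tendsto_weighted_jumps:
  fixes \<gamma> :: "real \<Rightarrow> 'a::banach" and h \<eta> :: "'k \<Rightarrow> real \<Rightarrow> (real \<Rightarrow> 'b::real_normed_vector) \<Rightarrow> real"
  assumes r: "r \<ge> 0" and \<psi>: "\<psi> \<in> Cspace r" and \<gamma>: "continuous_on {-r..0} \<gamma>"
    and cont: "\<And>k. k \<in> K \<Longrightarrow> contRC r (\<eta> k)" "\<And>k. k \<in> K \<Longrightarrow> contRC r (h k)"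
    and \<eta>: "\<And>k t \<phi>. k \<in> K \<Longrightarrow> \<phi> \<in> Cspace r \<Longrightarrow> \<eta> k t \<phi> \<in> {0..r}"
    and summable: "\<And>t \<phi>. \<phi> \<in> Cspace r \<Longrightarrow> (\<lambda>k. \<bar>h k t \<phi>\<bar>) summable_on K"
    and tail: "\<And>M e. e > 0 \<Longrightarrow> \<exists>F. finite F \<and> F \<subseteq> K \<and> (\<forall>t. \<forall>\<phi>\<in>Cspace r.
        \<bar>t\<bar> \<le> M \<and> normC r \<phi> \<le> M \<longrightarrow> (\<Sum>\<^sub>\<infinity>k\<in>K - F. \<bar>h k t \<phi>\<bar>) \<le> e)"
  shows "((\<lambda>x. \<Sum>\<^sub>\<infinity>k\<in>K. h k (fst x) (snd x) *\<^sub>R \<gamma> (- \<eta> k (fst x) (snd x))) \<longlongrightarrow>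
      (\<Sum>\<^sub>\<infinity>k\<in>K. h k t \<psi> *\<^sub>R \<gamma> (- \<eta> k t \<psi>))) (nearC r t \<psi>)"
proof -
  have "bounded (\<gamma> ` {-r..0})"
    using \<gamma> by (intro compact_imp_bounded compact_continuous_image) auto
  then obtain c where c: "c > 0" "\<And>\<theta>. \<theta> \<in> {-r..0} \<Longrightarrow> norm (\<gamma> \<theta>) \<le> c"
    by (auto simp: bounded_pos)
  have term_le: "norm (h k s \<phi> *\<^sub>R \<gamma> (- \<eta> k s \<phi>)) \<le> \<bar>h k s \<phi>\<bar> * c" if "k \<in> K" "\<phi> \<in> Cspace r" for k s \<phi>
    using \<eta>[OF that, of s] by (auto intro!: mult_left_mono c)
  have abs: "(\<lambda>k. norm (h k s \<phi> *\<^sub>R \<gamma> (- \<eta> k s \<phi>))) summable_on K" if "\<phi> \<in> Cspace r" for s \<phi>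
    by (rule summable_on_comparison_test[OF summable_on_cmult_left[OF summable[OF that, of s], of c]])
       (use term_le that in auto)
  have sub: "(\<lambda>k. h k s \<phi> *\<^sub>R \<gamma> (- \<eta> k s \<phi>)) summable_on B" "(\<lambda>k. \<bar>h k s \<phi>\<bar>) summable_on B"
    if "\<phi> \<in> Cspace r" "B \<subseteq> K" for s \<phi> B
    using abs_summable_summable[OF abs[OF that(1), of s]] summable[OF that(1), of s] that(2)
    by (auto intro: summable_on_subset_banach)
  show ?thesis
  proof (rule tendsto_infsum_uniform_tail)
    fix k assume k: "k \<in> K"
    have "((\<lambda>x. \<gamma> (- \<eta> k (fst x) (snd x))) \<longlongrightarrow> \<gamma> (- \<eta> k t \<psi>)) (nearC r t \<psi>)"
    proof (rule continuous_on_tendsto_compose[OF \<gamma>])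
      show "((\<lambda>x. - \<eta> k (fst x) (snd x)) \<longlongrightarrow> - \<eta> k t \<psi>) (nearC r t \<psi>)"
        by (intro tendsto_minus contRC_tendsto cont k \<psi>)
      show "- \<eta> k t \<psi> \<in> {-r..0}"
        using \<eta>[OF k \<psi>, of t] by simp
      show "\<forall>\<^sub>F x in nearC r t \<psi>. - \<eta> k (fst x) (snd x) \<in> {-r..0}"
        using eventually_nearC_Cspace[of r t \<psi>] by eventually_elim (use \<eta>[OF k] in auto)
    qed
    with contRC_tendsto[OF cont(2)[OF k] \<psi>, of t]
    show "((\<lambda>x. h k (fst x) (snd x) *\<^sub>R \<gamma> (- \<eta> k (fst x) (snd x))) \<longlongrightarrow> h k t \<psi> *\<^sub>R \<gamma> (- \<eta> k t \<psi>)) (nearC r t \<psi>)"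
      by (rule tendsto_scaleR)
  next
    show "(\<lambda>k. h k t \<psi> *\<^sub>R \<gamma> (- \<eta> k t \<psi>)) summable_on K"
      using sub(1)[OF \<psi>] by simp
    show "\<forall>\<^sub>F x in nearC r t \<psi>. (\<lambda>k. h k (fst x) (snd x) *\<^sub>R \<gamma> (- \<eta> k (fst x) (snd x))) summable_on K"
      using eventually_nearC_Cspace[of r t \<psi>] by eventually_elim (use sub(1) in auto)
  next
    fix e :: real assume "e > 0"
    \<comment> \<open>The added 1 puts the base point strictly inside the bounded set, so nearby
      points stay in it.\<close>
    define M where "M = max \<bar>t\<bar> (normC r \<psi>) + 1"
    have M: "\<bar>t\<bar> < M" "normC r \<psi> < M" by (auto simp: M_def)
    have "e / c > 0" using \<open>e > 0\<close> c by simp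
    from tail[OF this, of M] obtain F where F: "finite F" "F \<subseteq> K"
      "\<And>t \<phi>. \<phi> \<in> Cspace r \<Longrightarrow> \<bar>t\<bar> \<le> M \<Longrightarrow> normC r \<phi> \<le> M \<Longrightarrow> (\<Sum>\<^sub>\<infinity>k\<in>K - F. \<bar>h k t \<phi>\<bar>) \<le> e / c"
      by blast
    have *: "norm (\<Sum>\<^sub>\<infinity>k\<in>K - F. h k s \<phi> *\<^sub>R \<gamma> (- \<eta> k s \<phi>)) \<le> e"
      if "\<phi> \<in> Cspace r" "\<bar>s\<bar> \<le> M" "normC r \<phi> \<le> M" for s \<phi>
    proof -
      have "norm (\<Sum>\<^sub>\<infinity>k\<in>K - F. h k s \<phi> *\<^sub>R \<gamma> (- \<eta> k s \<phi>)) \<le> (\<Sum>\<^sub>\<infinity>k\<in>K - F. \<bar>h k s \<phi>\<bar>) * c"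
        using that(1) term_le
        by (intro norm_infsum_le[OF has_sum_infsum[OF sub(1)] has_sum_cmult_left[OF has_sum_infsum[OF sub(2)]]]) auto
      also have "\<dots> \<le> e / c * c"
        using F(3)[OF that] c by (intro mult_right_mono) auto
      finally show ?thesis using c by simp
    qed
    have "\<forall>\<^sub>F x in nearC r t \<psi>. norm (\<Sum>\<^sub>\<infinity>k\<in>K - F. h k (fst x) (snd x) *\<^sub>R \<gamma> (- \<eta> k (fst x) (snd x))) \<le> e"
      using eventually_nearC_Cspace[of r t \<psi>] eventually_nearC_bounded[OF r \<psi> M]
      by eventually_elim (use * in auto)
    moreover have "norm (\<Sum>\<^sub>\<infinity>k\<in>K - F. h k t \<psi> *\<^sub>R \<gamma> (- \<eta> k t \<psi>)) \<le> e"
      using M by (intro * \<psi>) auto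
    ultimately show "\<exists>F. finite F \<and> F \<subseteq> K \<and> norm (\<Sum>\<^sub>\<infinity>k\<in>K - F. h k t \<psi> *\<^sub>R \<gamma> (- \<eta> k t \<psi>)) \<le> e \<and>
        (\<forall>\<^sub>F x in nearC r t \<psi>. norm (\<Sum>\<^sub>\<infinity>k\<in>K - F. h k (fst x) (snd x) *\<^sub>R \<gamma> (- \<eta> k (fst x) (snd x))) \<le> e)"
      using F(1,2) by blast
  qed
qed

lemma dist_less_via_approx:
  fixes x y x' y' :: "'a::real_normed_vector"
  assumes "norm (x - x') \<le> e" "norm (y - y') \<le> e" "dist x' y' < d"
  shows "dist x y < 2 * e + d"
  using assms dist_triangle[of x y x'] dist_triangle[of x' y y'] by (simp add: dist_norm norm_minus_commute)

theorem theorem1: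
  fixes r :: real
    and G :: "real \<Rightarrow> 'a::banach \<Rightarrow> 'a \<Rightarrow> 'a"
    and p :: "real \<Rightarrow> 'a \<Rightarrow> 'a"
    and g :: "real \<Rightarrow> real \<Rightarrow> (real \<Rightarrow> 'a) \<Rightarrow> real"
    and Lp C1 C2 M_Vg :: real
  assumes r_pos: "r > 0"
    and G_cont: "continuous_on UNIV (\<lambda>(t, u, v). G t u v)"
    and Lp_nonneg: "Lp \<ge> 0"
    and p_lip: "\<And>t u s v. norm (p t u - p s v) \<le> Lp * (\<bar>s - t\<bar> + norm (u - v))"
    and C_nonneg: "C1 \<ge> 0" "C2 \<ge> 0"
    and p_growth: "\<And>s u. norm (p s u) \<le> C1 * norm u + C2"
    and A1: "M_Vg > 0"
      "\<And>t \<phi>. \<phi> \<in> Cspace r \<Longrightarrow> bounded_variation_on (-r) 0 (\<lambda>\<theta>. g \<theta> t \<phi>)"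
      "\<And>t \<phi>. \<phi> \<in> Cspace r \<Longrightarrow> total_variation (-r) 0 (\<lambda>\<theta>. g \<theta> t \<phi>) \<le> M_Vg"
    and A2: "\<And>\<theta>. \<theta> \<in> {-r..0} \<Longrightarrow> contRC r (\<lambda>t \<phi>. cont_part (-r) 0 (\<lambda>\<theta>'. g \<theta>' t \<phi>) \<theta>)"
    and A3: "\<exists>(K :: nat set) (\<eta> :: nat \<Rightarrow> real \<Rightarrow> (real \<Rightarrow> 'a) \<Rightarrow> real)
                 (h :: nat \<Rightarrow> real \<Rightarrow> (real \<Rightarrow> 'a) \<Rightarrow> real).
        (\<forall>k\<in>K. contRC r (\<eta> k) \<and> contRC r (h k)) \<and>
        (\<forall>k\<in>K. \<forall>t. \<forall>\<phi>\<in>Cspace r. \<eta> k t \<phi> \<in> {0..r}) \<and>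
        (\<forall>t. \<forall>\<phi>\<in>Cspace r.
           inj_on (\<lambda>k. \<eta> k t \<phi>) K \<and>
           {\<theta> \<in> {-r..0}. \<not> continuous (at \<theta> within {-r..0})
                                 (jump_part (-r) 0 (\<lambda>\<theta>'. g \<theta>' t \<phi>))}
             = (\<lambda>k. - \<eta> k t \<phi>) ` K \<and>
           (\<forall>k\<in>K. h k t \<phi> = jump_at (-r) 0 (jump_part (-r) 0 (\<lambda>\<theta>'. g \<theta>' t \<phi>)) (- \<eta> k t \<phi>)) \<and>
           (\<lambda>k. \<bar>h k t \<phi>\<bar>) summable_on K) \<and>
        (\<forall>M \<epsilon>. \<epsilon> > 0 \<longrightarrow> (\<exists>F. finite F \<and> F \<subseteq> K \<and>
           (\<forall>t. \<forall>\<phi>\<in>Cspace r. \<bar>t\<bar> \<le> M \<and> normC r \<phi> \<le> M \<longrightarrow>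
              infsum (\<lambda>k. \<bar>h k t \<phi>\<bar>) (K - F) \<le> \<epsilon>)))"
  shows "contRC r (\<lambda>t \<psi>. G t (\<psi> 0)
            (RS_integral (-r) 0 (\<lambda>\<theta>. p t (\<psi> \<theta>)) (\<lambda>\<theta>. g \<theta> t \<psi>)))"
proof -
  obtain K :: "nat set" and \<eta> h :: "nat \<Rightarrow> real \<Rightarrow> (real \<Rightarrow> 'a) \<Rightarrow> real" where
    K: "\<forall>k\<in>K. contRC r (\<eta> k) \<and> contRC r (h k)"
      "\<forall>k\<in>K. \<forall>t. \<forall>\<phi>\<in>Cspace r. \<eta> k t \<phi> \<in> {0..r}"
    and jumps: "\<forall>t. \<forall>\<phi>\<in>Cspace r.
      inj_on (\<lambda>k. \<eta> k t \<phi>) K \<and>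
      {\<theta> \<in> {-r..0}. \<not> continuous (at \<theta> within {-r..0}) (jump_part (-r) 0 (\<lambda>\<theta>'. g \<theta>' t \<phi>))}
        = (\<lambda>k. - \<eta> k t \<phi>) ` K \<and>
      (\<forall>k\<in>K. h k t \<phi> = jump_at (-r) 0 (jump_part (-r) 0 (\<lambda>\<theta>'. g \<theta>' t \<phi>)) (- \<eta> k t \<phi>)) \<and>
      (\<lambda>k. \<bar>h k t \<phi>\<bar>) summable_on K"
    and tail: "\<forall>M e. e > 0 \<longrightarrow> (\<exists>F. finite F \<and> F \<subseteq> K \<and> (\<forall>t. \<forall>\<phi>\<in>Cspace r.
        \<bar>t\<bar> \<le> M \<and> normC r \<phi> \<le> M \<longrightarrow> (\<Sum>\<^sub>\<infinity>k\<in>K - F. \<bar>h k t \<phi>\<bar>) \<le> e))"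
    using A3 by (elim exE conjE) (rule that)
  note cont = K(1)[rule_format, THEN conjunct1] K(1)[rule_format, THEN conjunct2]
    and \<eta> = K(2)[rule_format]
    and inj = jumps[rule_format, THEN conjunct1]
    and disc = jumps[rule_format, THEN conjunct2, THEN conjunct1]
    and h = bspec[OF jumps[rule_format, THEN conjunct2, THEN conjunct2, THEN conjunct1]]
    and summable = jumps[rule_format, THEN conjunct2, THEN conjunct2, THEN conjunct2]
  have p_cont: "continuous_on {-r..0} (\<lambda>\<theta>. p t (\<phi> \<theta>))" if "\<phi> \<in> Cspace r" for t \<phi>
  proof (rule continuous_on_compose2[of UNIV "p t" "{-r..0}" \<phi>])
    have "Lp-lipschitz_on UNIV (p t)"
      using p_lip[of t _ t] Lp_nonneg by (intro lipschitz_onI) (auto simp: dist_norm)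
    then show "continuous_on UNIV (p t)" by (rule lipschitz_on_continuous_on)
  qed (use that in \<open>auto simp: Cspace_def\<close>)
  define \<F> where "\<F> = (\<lambda>t \<psi>. RS_integral (-r) 0 (\<lambda>\<theta>. p t (\<psi> \<theta>)) (\<lambda>\<theta>. g \<theta> t \<psi>))"
  have \<F>_lim: "((\<lambda>x. \<F> (fst x) (snd x)) \<longlongrightarrow> \<F> t \<psi>) (nearC r t \<psi>)" if \<psi>: "\<psi> \<in> Cspace r" for t \<psi>
  proof (rule tendstoI)
    fix \<epsilon> :: real assume \<epsilon>: "\<epsilon> > 0"
    \<comment> \<open>One approximation costs \<open>3 * e * M_Vg\<close>, that is
      \<open>\<epsilon> / 4\<close>. It is paid at the moving point and at the base point; the
      change of \<open>Q\<close> takes the other half of \<open>\<epsilon>\<close>.\<close>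
    define e where "e = \<epsilon> / (12 * M_Vg)"
    have e: "e > 0" using \<epsilon> A1(1) by (simp add: e_def)
    define \<gamma> where "\<gamma> = (\<lambda>\<theta>. p t (\<psi> \<theta>))"
    have \<gamma>: "continuous_on {-r..0} \<gamma>"
      unfolding \<gamma>_def by (rule p_cont[OF \<psi>])
    from continuous_on_Icc_modulus[OF \<gamma> e] obtain d where d: "d > 0"
      "\<And>x y. x \<in> {-r..0} \<Longrightarrow> y \<in> {-r..0} \<Longrightarrow> \<bar>x - y\<bar> < d \<Longrightarrow> norm (\<gamma> x - \<gamma> y) \<le> e"
      by blast
    have "d / 2 > 0" using d(1) by simp
    from eventually_happens[OF eventually_uniform_mesh_less[OF this, of 0 "-r"]]
    obtain n :: nat where n: "n > 0" "(0 - - r) / real n < d / 2" by auto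
    \<comment> \<open>The integrand is frozen here: \<open>s\<close> and \<open>\<phi>\<close> enter
      only through \<open>g\<close>, \<open>h\<close> and \<open>\<eta>\<close>.\<close>
    define Q where "Q = (\<lambda>s \<phi>. uniform_sum (-r) 0 n \<gamma> (cont_part (-r) 0 (\<lambda>\<theta>. g \<theta> s \<phi>))
        + (\<Sum>\<^sub>\<infinity>k\<in>K. h k s \<phi> *\<^sub>R \<gamma> (- \<eta> k s \<phi>)))"
    have approx: "norm (\<F> s \<phi> - Q s \<phi>) \<le> \<epsilon> / 4"
      if \<phi>: "\<phi> \<in> Cspace r" and close: "\<And>\<theta>. \<theta> \<in> {-r..0} \<Longrightarrow> norm (p s (\<phi> \<theta>) - \<gamma> \<theta>) \<le> e" for s \<phi>
    proof -
      have "norm (\<F> s \<phi> - Q s \<phi>) \<le> 3 * e * M_Vg"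
        unfolding \<F>_def Q_def
      proof (rule RS_integral_approx[OF A1(2,3)[OF \<phi>] _ p_cont[OF \<phi>] \<gamma> d(1) n d(2) close])
        show "inj_on (\<lambda>k. - \<eta> k s \<phi>) K"
          using inj[OF \<phi>, of s] by (auto simp: inj_on_def)
      qed (use r_pos disc[OF \<phi>] h[OF \<phi>] in auto)
      then show ?thesis using A1(1) by (simp add: e_def)
    qed
    have "((\<lambda>x. Q (fst x) (snd x)) \<longlongrightarrow> Q t \<psi>) (nearC r t \<psi>)"
      unfolding Q_def
    proof (rule tendsto_add)
      show "((\<lambda>x. uniform_sum (-r) 0 n \<gamma> (cont_part (-r) 0 (\<lambda>\<theta>. g \<theta> (fst x) (snd x)))) \<longlongrightarrow>
          uniform_sum (-r) 0 n \<gamma> (cont_part (-r) 0 (\<lambda>\<theta>. g \<theta> t \<psi>))) (nearC r t \<psi>)"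
        unfolding uniform_sum_def using uniform_node_in[OF n(1), of "-r" 0] r_pos
        by (intro tendsto_sum tendsto_scaleR tendsto_diff tendsto_const contRC_tendsto[OF A2 \<psi>]) auto
      show "((\<lambda>x. \<Sum>\<^sub>\<infinity>k\<in>K. h k (fst x) (snd x) *\<^sub>R \<gamma> (- \<eta> k (fst x) (snd x))) \<longlongrightarrow>
          (\<Sum>\<^sub>\<infinity>k\<in>K. h k t \<psi> *\<^sub>R \<gamma> (- \<eta> k t \<psi>))) (nearC r t \<psi>)"
        using r_pos by (intro tendsto_weighted_jumps \<psi> \<gamma> cont \<eta> summable tail[rule_format]) auto
    qed
    then have "\<forall>\<^sub>F x in nearC r t \<psi>. dist (Q (fst x) (snd x)) (Q t \<psi>) < \<epsilon> / 2"
      using \<epsilon> by (intro tendstoD) auto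
    \<comment> \<open>Time and state each move by less than this radius, and \<open>2 * Lp\<close>
      times it is at most \<open>e\<close>; the summand 1 covers \<open>Lp = 0\<close>.\<close>
    moreover have "e / (2 * Lp + 1) > 0" using e Lp_nonneg by simp
    note eventually_nearC_close[OF this, of t r \<psi>]
    ultimately show "\<forall>\<^sub>F x in nearC r t \<psi>. dist (\<F> (fst x) (snd x)) (\<F> t \<psi>) < \<epsilon>"
      using eventually_nearC_Cspace[of r t \<psi>]
    proof eventually_elim
      case (elim x)
      have "norm (p (fst x) (snd x \<theta>) - \<gamma> \<theta>) \<le> e" if "\<theta> \<in> {-r..0}" for \<theta>
      proof -
        have "norm (p (fst x) (snd x \<theta>) - \<gamma> \<theta>) \<le> Lp * (\<bar>t - fst x\<bar> + norm (snd x \<theta> - \<psi> \<theta>))"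
          unfolding \<gamma>_def by (rule p_lip)
        also have "\<dots> \<le> Lp * (2 * (e / (2 * Lp + 1)))"
          using elim(2) norm_diff_le_normC[OF elim(3) \<psi> that] Lp_nonneg by (intro mult_left_mono) auto
        also have "\<dots> \<le> e"
          using e Lp_nonneg by (simp add: field_simps)
        finally show ?thesis .
      qed
      then have "norm (\<F> (fst x) (snd x) - Q (fst x) (snd x)) \<le> \<epsilon> / 4"
        by (rule approx[OF elim(3)])
      \<comment> \<open>At the base point the integrand is \<open>\<gamma>\<close> itself, so the
        closeness condition is trivial.\<close>
      moreover have "norm (\<F> t \<psi> - Q t \<psi>) \<le> \<epsilon> / 4"
        using e by (intro approx \<psi>) (simp add: \<gamma>_def)
      ultimately show ?case
        using dist_less_via_approx[OF _ _ elim(1)] by fastforce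
    qed
  qed
  have "((\<lambda>x. G (fst x) (snd x 0) (\<F> (fst x) (snd x))) \<longlongrightarrow> G t (\<psi> 0) (\<F> t \<psi>)) (nearC r t \<psi>)"
    if \<psi>: "\<psi> \<in> Cspace r" for t \<psi>
  proof -
    have "((\<lambda>x. (fst x, snd x 0, \<F> (fst x) (snd x))) \<longlongrightarrow> (t, \<psi> 0, \<F> t \<psi>)) (nearC r t \<psi>)"
      using r_pos by (intro tendsto_Pair tendsto_fst_nearC tendsto_snd_nearC \<F>_lim \<psi>) auto
    from continuous_on_tendsto_compose[OF G_cont this] show ?thesis by simp
  qed
  then show ?thesis
    unfolding contRC_iff_tendsto \<F>_def by blast
qed

end
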